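(* Let $(X,\mathcal{B},\mu,f)$ be an invertible dissipative measurable system of bounded distortion, let $p\ge1$ be a real number, and let $T_f,T_{f^{-1}}:L^p(X)\to L^p(X)$, $T_f\varphi=\varphi\circ f$, $T_{f^{-1}}\varphi=\varphi\circ f^{-1}$, be the associated composition operators. Then $T_f$ is frequently hypercyclic if and only if $(T_f)^{-1}$ is frequently hypercyclic; and $T_f$ is chaotic if and only if $(T_f)^{-1}$ is chaotic.
   Context: A measurable system is a tuple $(X,\mathcal{B},\mu,f)$ where: $(X,\mathcal{B},\mu)$ is a $\sigma$-finite measure space with $\mu(X)>0$; $f:X\to X$ is bijective, bimeasurable ($f(B),f^{-1}(B)\in\mathcal{B}$ for all $B\in\mathcal{B}$) and nonsingular ($\mu(f^{-1}(B))=0$ if and only if $\mu(B)=0$); and there is $c>0$ with $\mu(f^{-1}(B))\le c\,\mu(B)$ for all $B\in\mathcal{B}$. The system is invertible if this last condition is satisfied by both $f$ and $f^{-1}$, i.e. there is also $c'>0$ with $\mu(f(B))\le c'\mu(B)$ for all $B\in\mathcal{B}$. Then $T_f$ and $T_{f^{-1}}$ are continuous linear operators on $L^p(X)$. A measurable set $W$ is wandering if the sets $f^n(W)$, $n\in\mathbb{Z}$, are pairwise disjoint. The system is dissipative if there is a wandering set $W$ with $X=\bigcup_{n\in\mathbb{Z}}f^n(W)$. A dissipative system is of bounded distortion if there exist a wandering set $W$ with $0<\mu(W)<\infty$ and $K>0$ such that (i) $X=\bigcup_{n\in\mathbb{Z}}f^n(W)$; (ii) for all $n\in\mathbb{Z}$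 and all measurable $C\subseteq W$ with $\mu(C)>0$, $$\frac1K\,\frac{\mu(f^n(W))}{\mu(W)}\le\frac{\mu(f^n(C))}{\mu(C)}\le K\,\frac{\mu(f^n(W))}{\mu(W)}.$$ Let $T$ be a continuous linear operator on a Banach space $\mathcal{H}$. $T$ is topologically transitive if for all non-empty open $U,V\subseteq\mathcal{H}$ there is $k>0$ with $T^k(U)\cap V\ne\emptyset$; $T$ is chaotic if it is topologically transitive and its periodic points are dense in $\mathcal{H}$; $T$ is frequently hypercyclic if there is $\varphi\in\mathcal{H}$ such that for every non-empty open $U\subseteq\mathcal{H}$, $\liminf_{N\to\infty}\frac1N\#\{1\le n\le N: T^n\varphi\in U\}>0$. *)

theory Defs
  imports "HOL-Analysis.Analysis"
begin

section \<open>Measurable systems\<close>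

text \<open>The space \<open>X\<close> is \<^term>\<open>space M\<close>. The map \<open>f\<close> is total on the type, but only its
  restriction to \<^term>\<open>space M\<close> matters; in particular preimages are cut down to \<^term>\<open>space M\<close>
  and the inverse of \<open>f\<close> is \<^term>\<open>inv_into (space M) f\<close>.\<close>

locale measurable_system = sigma_finite_measure M
  for M :: "'a measure" and f :: "'a \<Rightarrow> 'a" +
  assumes space_pos: "emeasure M (space M) > 0"
    and bij: "bij_betw f (space M) (space M)"
    and image_sets: "B \<in> sets M \<Longrightarrow> f ` B \<in> sets M"
    and vimage_sets: "B \<in> sets M \<Longrightarrow> f -` B \<inter> space M \<in> sets M"
    and nonsingular:
      "B \<in> sets M \<Longrightarrow> emeasure M (f -` B \<inter> space M) = 0 \<longleftrightarrow> emeasure M B = 0"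
    and vimage_bound:
      "\<exists>c::real. c > 0 \<and> (\<forall>B\<in>sets M. emeasure M (f -` B \<inter> space M) \<le> ennreal c * emeasure M B)"

locale invertible_measurable_system = measurable_system +
  assumes image_bound:
    "\<exists>c::real. c > 0 \<and> (\<forall>B\<in>sets M. emeasure M (f ` B) \<le> ennreal c * emeasure M B)"

definition int_iterate :: "'a set \<Rightarrow> ('a \<Rightarrow> 'a) \<Rightarrow> int \<Rightarrow> 'a \<Rightarrow> 'a" where
  "int_iterate X f n = (if n \<ge> 0 then f ^^ nat n else inv_into X f ^^ nat (- n))"

definition wandering :: "'a measure \<Rightarrow> ('a \<Rightarrow> 'a) \<Rightarrow> 'a set \<Rightarrow> bool" where
  "wandering M f W \<longleftrightarrow>
     W \<in> sets M \<and> disjoint_family (\<lambda>n::int. int_iterate (space M) f n ` W)"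

definition dissipative :: "'a measure \<Rightarrow> ('a \<Rightarrow> 'a) \<Rightarrow> bool" where
  "dissipative M f \<longleftrightarrow>
     (\<exists>W. wandering M f W \<and> space M = (\<Union>n::int. int_iterate (space M) f n ` W))"

definition bounded_distortion :: "'a measure \<Rightarrow> ('a \<Rightarrow> 'a) \<Rightarrow> bool" where
  "bounded_distortion M f \<longleftrightarrow>
     (\<exists>W. \<exists>K::real. wandering M f W \<and> 0 < emeasure M W \<and> emeasure M W < \<infinity> \<and> K > 0 \<and>
        space M = (\<Union>n::int. int_iterate (space M) f n ` W) \<and>
        (\<forall>n::int. \<forall>C\<in>sets M. C \<subseteq> W \<and> emeasure M C > 0 \<longrightarrow>
           ennreal (1 / K) * (emeasure M (int_iterate (space M) f n ` W) / emeasure M W)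
             \<le> emeasure M (int_iterate (space M) f n ` C) / emeasure M C \<and>
           emeasure M (int_iterate (space M) f n ` C) / emeasure M C
             \<le> ennreal K * (emeasure M (int_iterate (space M) f n ` W) / emeasure M W)))"


section \<open>The space \<open>L\<^sup>p\<close>\<close>

text \<open>The scalars range over the type class
  \<open>{real_normed_field, banach, second_countable_topology}\<close>, whose instances include \<open>real\<close> and
  \<open>complex\<close> (and are, up to isomorphism, only these two). Elements of \<open>L\<^sup>p\<close> are equivalence
  classes of \<open>p\<close>-integrable functions modulo equality almost everywhere.\<close>

definition Lp_functions ::
  "'a measure \<Rightarrow> real \<Rightarrow> ('a \<Rightarrow> 'k::{real_normed_field,banach,second_countable_topology}) set" where
  "Lp_functions M p =
     {g \<in> borel_measurable M. integrable M (\<lambda>x. norm (g x) powr p)}"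

definition Lp_norm ::
  "'a measure \<Rightarrow> real \<Rightarrow> ('a \<Rightarrow> 'k::{real_normed_field,banach,second_countable_topology}) \<Rightarrow> real" where
  "Lp_norm M p g = (\<integral>x. norm (g x) powr p \<partial>M) powr (1 / p)"

definition Lp_rel ::
  "'a measure \<Rightarrow> real \<Rightarrow> ('a \<Rightarrow> 'k::{real_normed_field,banach,second_countable_topology}) rel" where
  "Lp_rel M p =
     {(g, h). g \<in> Lp_functions M p \<and> h \<in> Lp_functions M p \<and> (AE x in M. g x = h x)}"

definition Lp_space ::
  "'a measure \<Rightarrow> real \<Rightarrow> ('a \<Rightarrow> 'k::{real_normed_field,banach,second_countable_topology}) set set" where
  "Lp_space M p = Lp_functions M p // Lp_rel M p"

text \<open>The choice of representatives is irrelevant, see \<open>Lp_dist_class\<close> below.\<close>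

definition Lp_dist ::
  "'a measure \<Rightarrow> real \<Rightarrow> ('a \<Rightarrow> 'k::{real_normed_field,banach,second_countable_topology}) set
     \<Rightarrow> ('a \<Rightarrow> 'k) set \<Rightarrow> real" where
  "Lp_dist M p A B = Lp_norm M p (\<lambda>x. (SOME g. g \<in> A) x - (SOME h. h \<in> B) x)"

definition Lp_topology ::
  "'a measure \<Rightarrow> real
     \<Rightarrow> ('a \<Rightarrow> 'k::{real_normed_field,banach,second_countable_topology}) set topology" where
  "Lp_topology M p = Metric_space.mtopology (Lp_space M p) (Lp_dist M p)"

text \<open>The operator \<open>\<phi> \<mapsto> \<phi> \<circ> f\<close> on equivalence classes, see \<open>composition_operator_class\<close> below.\<close>

definition composition_operator ::
  "'a measure \<Rightarrow> real \<Rightarrow> ('a \<Rightarrow> 'a)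
     \<Rightarrow> ('a \<Rightarrow> 'k::{real_normed_field,banach,second_countable_topology}) set \<Rightarrow> ('a \<Rightarrow> 'k) set" where
  "composition_operator M p f A = (\<Union>g\<in>A. Lp_rel M p `` {g \<circ> f})"


section \<open>Dynamics of a self-map of a topological space\<close>

definition topologically_transitive :: "'b topology \<Rightarrow> ('b \<Rightarrow> 'b) \<Rightarrow> bool" where
  "topologically_transitive \<T> T \<longleftrightarrow>
     (\<forall>U V. openin \<T> U \<and> U \<noteq> {} \<and> openin \<T> V \<and> V \<noteq> {} \<longrightarrow>
        (\<exists>k>0. (T ^^ k) ` U \<inter> V \<noteq> {}))"

definition periodic_points :: "'b topology \<Rightarrow> ('b \<Rightarrow> 'b) \<Rightarrow> 'b set" where
  "periodic_points \<T> T = {\<phi> \<in> topspace \<T>. \<exists>k>0. (T ^^ k) \<phi> = \<phi>}"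

definition chaotic :: "'b topology \<Rightarrow> ('b \<Rightarrow> 'b) \<Rightarrow> bool" where
  "chaotic \<T> T \<longleftrightarrow>
     topologically_transitive \<T> T \<and> \<T> closure_of periodic_points \<T> T = topspace \<T>"

definition frequently_hypercyclic :: "'b topology \<Rightarrow> ('b \<Rightarrow> 'b) \<Rightarrow> bool" where
  "frequently_hypercyclic \<T> T \<longleftrightarrow>
     (\<exists>\<phi>\<in>topspace \<T>. \<forall>U. openin \<T> U \<and> U \<noteq> {} \<longrightarrow>
        liminf (\<lambda>N. ereal (real (card {n \<in> {1..N}. (T ^^ n) \<phi> \<in> U}) / real N)) > 0)"


section \<open>Well-definedness\<close>

lemma equiv_Lp_rel: "equiv (Lp_functions M p) (Lp_rel M p)"
proof (rule equivI)
  show "trans (Lp_rel M p)"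
    unfolding trans_def Lp_rel_def by (auto elim: AE_mp)
qed (auto simp: Lp_rel_def refl_on_def sym_def elim: AE_mp)

lemma Lp_class_some:
  assumes "g \<in> Lp_functions M p"
  shows "(SOME h. h \<in> Lp_rel M p `` {g}) \<in> Lp_functions M p"
    and "AE x in M. (SOME h. h \<in> Lp_rel M p `` {g}) x = g x"
proof -
  define k where "k = (SOME h. h \<in> Lp_rel M p `` {g})"
  have "g \<in> Lp_rel M p `` {g}"
    using assms by (simp add: Lp_rel_def)
  then have "k \<in> Lp_rel M p `` {g}"
    unfolding k_def by (rule someI[of "\<lambda>h. h \<in> Lp_rel M p `` {g}"])
  then have "k \<in> Lp_functions M p" "AE x in M. k x = g x"
    by (auto simp: Lp_rel_def elim: AE_mp)
  then show "(SOME h. h \<in> Lp_rel M p `` {g}) \<in> Lp_functions M p"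
    and "AE x in M. (SOME h. h \<in> Lp_rel M p `` {g}) x = g x"
    by (simp_all add: k_def)
qed

lemma Lp_functions_measurable: "g \<in> Lp_functions M p \<Longrightarrow> g \<in> borel_measurable M"
  by (simp add: Lp_functions_def)

lemma Lp_norm_cong_AE:
  assumes "g \<in> borel_measurable M" "h \<in> borel_measurable M" "AE x in M. g x = h x"
  shows "Lp_norm M p g = Lp_norm M p h"
proof -
  have "(\<integral>x. norm (g x) powr p \<partial>M) = (\<integral>x. norm (h x) powr p \<partial>M)"
    using assms by (intro integral_cong_AE) auto
  then show ?thesis by (simp add: Lp_norm_def)
qed

lemma Lp_dist_class:
  assumes g: "g \<in> Lp_functions M p" and h: "h \<in> Lp_functions M p"
  shows "Lp_dist M p (Lp_rel M p `` {g}) (Lp_rel M p `` {h}) = Lp_norm M p (\<lambda>x. g x - h x)"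
  unfolding Lp_dist_def
proof (rule Lp_norm_cong_AE)
  show "AE x in M. (SOME k. k \<in> Lp_rel M p `` {g}) x - (SOME k. k \<in> Lp_rel M p `` {h}) x = g x - h x"
    using Lp_class_some(2)[OF g] Lp_class_some(2)[OF h] by eventually_elim simp
qed (use Lp_class_some(1)[OF g] Lp_class_some(1)[OF h] g h in
      \<open>auto intro!: borel_measurable_diff dest: Lp_functions_measurable\<close>)

lemma Lp_functions_diff:
  assumes p: "p \<ge> 1" and g: "g \<in> Lp_functions M p" and h: "h \<in> Lp_functions M p"
  shows "(\<lambda>x. g x - h x) \<in> Lp_functions M p"
proof -
  have meas: "g \<in> borel_measurable M" "h \<in> borel_measurable M"
    using g h by (auto simp: Lp_functions_def)
  have "integrable M (\<lambda>x. 2 powr p * (norm (g x) powr p + norm (h x) powr p))"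
    using g h by (auto simp: Lp_functions_def)
  moreover have "norm (g x - h x) powr p \<le> 2 powr p * (norm (g x) powr p + norm (h x) powr p)" for x
  proof -
    have "norm (g x - h x) \<le> 2 * max (norm (g x)) (norm (h x))"
      using norm_triangle_ineq4[of "g x" "h x"] by linarith
    then have "norm (g x - h x) powr p \<le> (2 * max (norm (g x)) (norm (h x))) powr p"
      using p by (intro powr_mono2) auto
    also have "\<dots> = 2 powr p * max (norm (g x)) (norm (h x)) powr p"
      by (intro powr_mult) 
    also have "\<dots> \<le> 2 powr p * (norm (g x) powr p + norm (h x) powr p)"
      by (intro mult_left_mono) (auto simp: max_def)
    finally show ?thesis .
  qed
  ultimately have "integrable M (\<lambda>x. norm (g x - h x) powr p)"
    using meas by (elim Bochner_Integration.integrable_bound) auto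
  then show ?thesis
    using meas by (simp add: Lp_functions_def)
qed

lemma Lp_norm_powr:
  assumes "p \<ge> 1"
  shows "Lp_norm M p g powr p = (\<integral>x. norm (g x) powr p \<partial>M)"
  using assms by (simp add: Lp_norm_def powr_powr)

lemma Lp_norm_eq_0:
  assumes "p \<ge> 1" "g \<in> Lp_functions M p"
  shows "Lp_norm M p g = 0 \<longleftrightarrow> (AE x in M. g x = 0)"
proof -
  have "Lp_norm M p g = 0 \<longleftrightarrow> (\<integral>x. norm (g x) powr p \<partial>M) = 0"
    using assms(1) by (simp add: Lp_norm_def)
  also have "\<dots> \<longleftrightarrow> (AE x in M. norm (g x) powr p = 0)"
    using assms by (intro integral_nonneg_eq_0_iff_AE) (auto simp: Lp_functions_def)
  finally show ?thesis by simp
qed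

lemma convex_powr_nonneg:
  fixes p s t u v :: real
  assumes p: "p \<ge> 1" and nn: "s \<ge> 0" "t \<ge> 0" and uv: "u > 0" "v > 0" "u + v = 1"
  shows "(u * s + v * t) powr p \<le> u * s powr p + v * t powr p"
proof -
  have less: "u powr p \<le> u" "v powr p \<le> v"
    using p uv powr_mono'[of 1 p u] powr_mono'[of 1 p v] by auto
  show ?thesis
  proof (cases "s = 0 \<or> t = 0")
    case True
    then show ?thesis
      using p uv nn less by (auto simp: powr_mult intro!: mult_right_mono)
  next
    case False
    have u: "u = 1 - v" using uv(3) by simp
    from False show ?thesis
      using convex_onD[OF powr_convex[OF p], of v s t] nn uv(1,2) u
      by simp
  qed
qed

lemma Lp_norm_triangle:
  assumes p: "p \<ge> 1" and g: "g \<in> Lp_functions M p" and h: "h \<in> Lp_functions M p"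
  shows "Lp_norm M p (\<lambda>x. g x - h x) \<le> Lp_norm M p g + Lp_norm M p h"
proof -
  define a b where "a = Lp_norm M p g" and "b = Lp_norm M p h"
  have nn: "a \<ge> 0" "b \<ge> 0" by (auto simp: a_def b_def Lp_norm_def)
  have meas: "g \<in> borel_measurable M" "h \<in> borel_measurable M"
    using g h by (auto simp: Lp_functions_def)
  consider "a = 0" | "b = 0" | "a > 0" "b > 0" using nn by linarith
  then have "Lp_norm M p (\<lambda>x. g x - h x) \<le> a + b"
  proof cases
    case 1
    then have "AE x in M. g x = 0" using Lp_norm_eq_0[OF p g] by (simp add: a_def)
    then have "AE x in M. norm (g x - h x) powr p = norm (h x) powr p"
      by eventually_elim simp
    then have "(\<integral>x. norm (g x - h x) powr p \<partial>M) = (\<integral>x. norm (h x) powr p \<partial>M)"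
      using meas by (intro integral_cong_AE) auto
    then show ?thesis using nn by (simp add: Lp_norm_def b_def)
  next
    case 2
    then have "AE x in M. h x = 0" using Lp_norm_eq_0[OF p h] by (simp add: b_def)
    then have "AE x in M. norm (g x - h x) powr p = norm (g x) powr p"
      by eventually_elim simp
    then have "(\<integral>x. norm (g x - h x) powr p \<partial>M) = (\<integral>x. norm (g x) powr p \<partial>M)"
      using meas by (intro integral_cong_AE) auto
    then show ?thesis using nn by (simp add: Lp_norm_def a_def)
  next
    case 3
    define u v where "u = a / (a + b)" and "v = b / (a + b)"
    have uv: "u > 0" "v > 0" "u + v = 1"
      using 3 by (auto simp: u_def v_def simp flip: add_divide_distrib)
    let ?B = "\<lambda>x. (a + b) powr p *
      (u * (norm (g x) powr p / a powr p) + v * (norm (h x) powr p / b powr p))"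
    have pw: "norm (g x - h x) powr p \<le> ?B x" for x
    proof -
      have "norm (g x - h x) powr p \<le> (norm (g x) + norm (h x)) powr p"
        using p norm_triangle_ineq4 by (intro powr_mono2) auto
      also have "norm (g x) + norm (h x) = (a + b) * (u * (norm (g x) / a) + v * (norm (h x) / b))"
      proof -
        have "(a + b) * (u * (norm (g x) / a)) = norm (g x)" "(a + b) * (v * (norm (h x) / b)) = norm (h x)"
          using 3 by (simp_all add: u_def v_def)
        then show ?thesis by (simp add: distrib_left)
      qed
      also have "\<dots> powr p = (a + b) powr p * (u * (norm (g x) / a) + v * (norm (h x) / b)) powr p"
        by (intro powr_mult)
      also have "\<dots> \<le> (a + b) powr p * (u * (norm (g x) / a) powr p + v * (norm (h x) / b) powr p)"
        using 3 uv p by (intro mult_left_mono convex_powr_nonneg) auto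
      also have "\<dots> = ?B x"
        using 3 by (simp add: powr_divide)
      finally show ?thesis .
    qed
    have int: "integrable M (\<lambda>x. norm (g x) powr p)" "integrable M (\<lambda>x. norm (h x) powr p)"
      using g h by (auto simp: Lp_functions_def)
    have "(\<integral>x. norm (g x - h x) powr p \<partial>M) \<le> (\<integral>x. ?B x \<partial>M)"
      using pw int Lp_functions_diff[OF p g h]
      by (intro integral_mono) (auto simp: Lp_functions_def)
    also have "\<dots> = (a + b) powr p * (u * (a powr p / a powr p) + v * (b powr p / b powr p))"
      using int by (simp add: a_def b_def Lp_norm_powr[OF p])
    also have "\<dots> = (a + b) powr p"
      using 3 uv by simp
    finally have "(\<integral>x. norm (g x - h x) powr p \<partial>M) powr (1 / p) \<le> ((a + b) powr p) powr (1 / p)"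
      using p by (intro powr_mono2) auto
    then show ?thesis
      using p nn by (simp add: Lp_norm_def powr_powr)
  qed
  then show ?thesis by (simp add: a_def b_def)
qed

lemma Metric_space_Lp:
  assumes p: "p \<ge> 1"
  shows "Metric_space (Lp_space M p) (Lp_dist M p)"
proof
  fix A B C :: "('a \<Rightarrow> 'b) set"
  show "0 \<le> Lp_dist M p A B" by (simp add: Lp_dist_def Lp_norm_def)
  show "Lp_dist M p A B = Lp_dist M p B A" by (simp add: Lp_dist_def Lp_norm_def norm_minus_commute)
  assume "A \<in> Lp_space M p" "B \<in> Lp_space M p"
  then obtain g h where g: "g \<in> Lp_functions M p" "A = Lp_rel M p `` {g}"
    and h: "h \<in> Lp_functions M p" "B = Lp_rel M p `` {h}"
    by (auto simp: Lp_space_def elim!: quotientE)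
  have "Lp_dist M p A B = 0 \<longleftrightarrow> (AE x in M. g x - h x = 0)"
    using Lp_norm_eq_0[OF p Lp_functions_diff[OF p g(1) h(1)]] g h by (simp add: Lp_dist_class)
  also have "\<dots> \<longleftrightarrow> (g, h) \<in> Lp_rel M p"
    using g h by (simp add: Lp_rel_def)
  also have "\<dots> \<longleftrightarrow> A = B"
    using g h eq_equiv_class_iff[OF equiv_Lp_rel, of g M p h] by simp
  finally show "Lp_dist M p A B = 0 \<longleftrightarrow> A = B" .
  assume "C \<in> Lp_space M p"
  then obtain k where k: "k \<in> Lp_functions M p" "C = Lp_rel M p `` {k}"
    by (auto simp: Lp_space_def elim!: quotientE)
  show "Lp_dist M p A C \<le> Lp_dist M p A B + Lp_dist M p B C"
    using Lp_norm_triangle[OF p Lp_functions_diff[OF p g(1) h(1)] Lp_functions_diff[OF p k(1) h(1)]]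
    using g h k by (simp add: Lp_dist_class Lp_norm_def norm_minus_commute)
qed

context measurable_system
begin

lemma measurable_f: "f \<in> measurable M M"
  using bij vimage_sets by (auto intro!: measurableI simp: bij_betw_def)

lemma AE_compose:
  assumes "AE x in M. P x"
  shows "AE x in M. P (f x)"
proof -
  obtain N where N: "{x \<in> space M. \<not> P x} \<subseteq> N" "emeasure M N = 0" "N \<in> sets M"
    using assms by (auto elim: AE_E)
  show ?thesis
  proof (rule AE_I)
    show "{x \<in> space M. \<not> P (f x)} \<subseteq> f -` N \<inter> space M"
      using N(1) bij by (auto simp: bij_betw_def)
    show "emeasure M (f -` N \<inter> space M) = 0" using N nonsingular by simp
  qed (rule vimage_sets[OF N(3)])
qed

lemma Lp_functions_compose:
  assumes "g \<in> Lp_functions M p"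
  shows "g \<circ> f \<in> Lp_functions M p"
proof -
  obtain c where c: "c > 0"
    "\<And>B. B \<in> sets M \<Longrightarrow> emeasure M (f -` B \<inter> space M) \<le> ennreal c * emeasure M B"
    using vimage_bound by auto
  have g: "g \<in> borel_measurable M" "(\<integral>\<^sup>+x. ennreal (norm (g x) powr p) \<partial>M) < \<infinity>"
    using assms by (auto simp: Lp_functions_def integrable_iff_bounded)
  let ?N = "distr M M f" and ?M = "scale_measure (ennreal c) M"
  have "(\<integral>\<^sup>+x. ennreal (norm (g (f x)) powr p) \<partial>M) = (\<integral>\<^sup>+x. ennreal (norm (g x) powr p) \<partial>?N)"
    using g(1) measurable_f by (subst nn_integral_distr) auto
  also have "\<dots> \<le> (\<integral>\<^sup>+x. ennreal (norm (g x) powr p) \<partial>?M)"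
  proof (rule nn_integral_mono_measure)
    show "?N \<le> ?M"
      by (rule le_measure[THEN iffD2]) (auto simp: le_fun_def emeasure_distr measurable_f c(2))
  qed simp
  also have "\<dots> = ennreal c * (\<integral>\<^sup>+x. ennreal (norm (g x) powr p) \<partial>M)"
    using g(1) by (intro nn_integral_scale_measure) auto
  also have "\<dots> < \<infinity>" using g(2) by (simp add: ennreal_mult_less_top)
  finally show ?thesis
    using measurable_compose[OF measurable_f g(1)]
    by (auto simp: Lp_functions_def integrable_iff_bounded comp_def)
qed

lemma composition_operator_class:
  fixes g :: "'a \<Rightarrow> 'k::{real_normed_field,banach,second_countable_topology}"
  assumes "g \<in> Lp_functions M p"
  shows "composition_operator M p f (Lp_rel M p `` {g}) = Lp_rel M p `` {g \<circ> f}"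
  unfolding composition_operator_def
proof (rule UN_equiv_class[OF equiv_Lp_rel _ assms])
  show "(\<lambda>g :: 'a \<Rightarrow> 'k. Lp_rel M p `` {g \<circ> f}) respects Lp_rel M p"
  proof (rule congruentI)
    fix g h :: "'a \<Rightarrow> 'k" assume "(g, h) \<in> Lp_rel M p"
    then have "(g \<circ> f, h \<circ> f) \<in> Lp_rel M p"
      using AE_compose[of "\<lambda>x. g x = h x"] Lp_functions_compose by (auto simp: Lp_rel_def)
    then show "Lp_rel M p `` {g \<circ> f} = Lp_rel M p `` {h \<circ> f}"
      by (rule equiv_class_eq[OF equiv_Lp_rel])
  qed
qed

end

end

theory Submission
  imports Defs
begin

text \<open>
  Chaos is symmetric for every invertible map. For frequent hypercyclicity, the pivot is the
  finiteness of \<open>\<mu>(X)\<close>, which does not distinguish \<open>f\<close> from its inverse.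

  If \<open>\<phi>\<close> is frequently hypercyclic for \<open>T\<^sub>f\<close>, let \<open>E\<close> be the set of times \<open>n\<close> at which \<open>\<phi> \<circ> f\<^sup>n\<close> is
  close to the indicator of \<open>W\<close>. For \<open>m, n \<in> E\<close> the function \<open>\<phi> \<circ> f\<^sup>n\<close> is large on a big part of
  \<open>f\<^sup>m\<^sup>-\<^sup>n(W)\<close>, so bounded distortion bounds \<open>\<Sum>m\<in>E. \<mu>(f\<^sup>m\<^sup>-\<^sup>n(W))\<close> uniformly in \<open>n \<in> E\<close>. Averaging
  over \<open>n\<close> bounds the sum of \<open>\<mu>(f\<^sup>k(W))\<close> over the \<open>k\<close> for which \<open>E \<inter> (E - k)\<close> has density at least
  \<open>\<eta>\<close>. Finitely many translates of this set of \<open>k\<close> cover the integers (an idea of Bayart and Ruzsa),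
  and translating costs only a factor because \<open>f\<close> and its inverse distort \<open>\<mu>\<close> boundedly; hence \<open>\<mu>(X) < \<infinity>\<close>.

  Conversely let \<open>\<mu>(X) < \<infinity>\<close> and let a dense sequence be given; here the orbit of \<open>\<phi>\<close> supplies it, so
  separability of \<open>L\<^sup>p\<close> need not be assumed. Truncate its members to bounded functions \<open>y\<^sub>l\<close>
  supported on finitely many \<open>f\<^sup>k(W)\<close>, and copy \<open>y\<^sub>l\<close> along \<open>f\<^sup>n\<close> for all \<open>n\<close> in a set \<open>A\<^sub>l\<close> of positive
  lower density. If the sets \<open>A\<^sub>l\<close> are sufficiently separated, the copies have disjoint supports
  and their sum is frequently hypercyclic.
\<close>

section \<open>Sets of positive lower density\<close>

text \<open>An eventual linear bound in place of a \<open>liminf\<close>, so that density estimates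
  compare counts in the reals without \<open>ereal\<close> arithmetic.\<close>

definition positive_lower_density :: "nat set \<Rightarrow> bool" where
  "positive_lower_density A \<longleftrightarrow>
     (\<exists>\<delta>>0. \<forall>\<^sub>F N in sequentially. \<delta> * real N \<le> real (card (A \<inter> {1..N})))"

lemma positive_lower_density_iff_liminf:
  "positive_lower_density {n. P n} \<longleftrightarrow>
     liminf (\<lambda>N. ereal (real (card {n \<in> {1..N}. P n}) / real N)) > 0"
proof -
  let ?x = "\<lambda>N. real (card {n \<in> {1..N}. P n}) / real N"
  have eq: "{n. P n} \<inter> {1..N} = {n \<in> {1..N}. P n}" for N :: nat by auto
  have pos: "\<forall>\<^sub>F N::nat in sequentially. N > 0"
    by (rule eventually_gt_at_top)
  show ?thesis
  proof
    assume "positive_lower_density {n. P n}"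
    then obtain \<delta> where \<delta>: "\<delta> > 0" "\<forall>\<^sub>F N in sequentially. \<delta> * real N \<le> real (card {n \<in> {1..N}. P n})"
      unfolding positive_lower_density_def eq by blast
    have "\<forall>\<^sub>F N in sequentially. ereal \<delta> \<le> ereal (?x N)"
      using \<delta>(2) pos by eventually_elim (simp add: field_simps)
    then have "ereal \<delta> \<le> liminf (\<lambda>N. ereal (?x N))"
      by (rule Liminf_bounded)
    then show "liminf (\<lambda>N. ereal (?x N)) > 0"
      using \<delta>(1) by (meson ereal_less(2) less_le_trans)
  next
    assume "liminf (\<lambda>N. ereal (?x N)) > 0"
    then obtain y where y: "0 < ereal y" "ereal y < liminf (\<lambda>N. ereal (?x N))"
      using ereal_dense2 by blast
    have "\<forall>\<^sub>F N in sequentially. ereal y < ereal (?x N)"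
      using less_LiminfD[OF y(2)] .
    then have "\<forall>\<^sub>F N in sequentially. y * real N \<le> real (card {n \<in> {1..N}. P n})"
      using pos by eventually_elim (simp add: field_simps)
    then show "positive_lower_density {n. P n}"
      unfolding positive_lower_density_def eq using y(1) by auto
  qed
qed

lemma positive_lower_density_mono:
  assumes "positive_lower_density A" "A \<subseteq> B"
  shows "positive_lower_density B"
proof -
  obtain \<delta> where \<delta>: "\<delta> > 0" "\<forall>\<^sub>F N in sequentially. \<delta> * real N \<le> real (card (A \<inter> {1..N}))"
    using assms(1) unfolding positive_lower_density_def by blast
  have le: "card (A \<inter> {1..N}) \<le> card (B \<inter> {1..N})" for N
    using assms(2) by (intro card_mono) auto
  have "\<forall>\<^sub>F N in sequentially. \<delta> * real N \<le> real (card (B \<inter> {1..N}))"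
    using \<delta>(2) by eventually_elim (use le in \<open>meson of_nat_le_iff order_trans\<close>)
  then show ?thesis
    using \<delta>(1) unfolding positive_lower_density_def by blast
qed

lemma positive_lower_density_infinite:
  assumes "positive_lower_density A"
  shows "infinite A"
proof
  assume "finite A"
  obtain \<delta> where \<delta>: "\<delta> > 0" "\<forall>\<^sub>F N in sequentially. \<delta> * real N \<le> real (card (A \<inter> {1..N}))"
    using assms unfolding positive_lower_density_def by blast
  have "\<forall>\<^sub>F N::nat in sequentially. real (card A) / \<delta> < real N"
    using filterlim_real_sequentially unfolding filterlim_at_top_dense by blast
  with \<delta>(2) have "\<forall>\<^sub>F N::nat in sequentially. False"
  proof eventually_elim
    case (elim N)
    have "card (A \<inter> {1..N}) \<le> card A" using \<open>finite A\<close> by (intro card_mono) auto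
    with elim \<delta>(1) show ?case by (simp add: field_simps)
  qed
  then show False by simp
qed

section \<open>Return densities, and sums controlled along return times\<close>

lemma convergent_subsequence_pointwise:
  fixes a :: "nat \<Rightarrow> 'i::countable \<Rightarrow> real"
  assumes "\<And>n i. a n i \<in> {0..1}"
  obtains r d where "strict_mono (r :: nat \<Rightarrow> nat)" "\<And>i. (\<lambda>n. a (r n) i) \<longlonglongrightarrow> d i"
proof -
  \<comment> \<open>The cube is compact by Tychonoff; since the index set is countable, the product
    is metrizable and the cube is sequentially compact.\<close>
  have "compactin (product_topology (\<lambda>i::'i. euclidean) UNIV) (PiE UNIV (\<lambda>i. {0..1::real}))"
    by (subst compactin_PiE) auto
  then have "compact (PiE UNIV (\<lambda>i::'i. {0..1::real}))"
    by (simp add: euclidean_product_topology)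
  then have "seq_compact (PiE UNIV (\<lambda>i::'i. {0..1::real}))"
    by (simp add: compact_eq_seq_compact_metric)
  moreover have "\<forall>n. a n \<in> PiE UNIV (\<lambda>i. {0..1})" using assms by auto
  ultimately obtain d r where "strict_mono (r :: nat \<Rightarrow> nat)" "(a \<circ> r) \<longlonglongrightarrow> d"
    unfolding seq_compact_def by metis
  moreover have "isCont (\<lambda>x. x i) d" for i :: 'i
    by (metis UNIV_I continuous_on_eq_continuous_at continuous_on_product_coordinates open_UNIV)
  ultimately have "(\<lambda>n. (a \<circ> r) n i) \<longlonglongrightarrow> d i" for i
    using isCont_tendsto_compose[of d "\<lambda>x. x i" "a \<circ> r" sequentially] by blast
  then show thesis
    using that \<open>strict_mono r\<close> by (auto simp: comp_def)
qed

text \<open>Translating by \<open>i\<close> loses only the points whose translate leaves the window,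
  and these fill a boundary strip \<open>?B\<close> of at most \<open>\<bar>i\<bar>\<close> points.
  Densities are therefore insensitive to fixed shifts.\<close>

lemma card_shift_le:
  fixes P :: "int \<Rightarrow> bool"
  shows "card {n \<in> {1..int N}. P n} \<le> card {n \<in> {1..int N}. P (n + i)} + nat \<bar>i\<bar>"
proof -
  let ?A = "{n \<in> {1..int N}. P (n + i)}"
  let ?B = "if i \<ge> 0 then {1..i} else {int N + i + 1..int N}"
  have finA: "finite ?A" by (rule finite_subset[of _ "{1..int N}"]) auto
  have "{n \<in> {1..int N}. P n} \<subseteq> (\<lambda>n. n + i) ` ?A \<union> ?B"
  proof
    fix n assume n: "n \<in> {n \<in> {1..int N}. P n}"
    show "n \<in> (\<lambda>n. n + i) ` ?A \<union> ?B"
    proof (cases "n - i \<in> {1..int N}")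
      case True
      with n have "n - i \<in> ?A" by auto
      then have "n \<in> (\<lambda>n. n + i) ` ?A" by (rule rev_image_eqI) simp
      then show ?thesis by blast
    qed (use n in \<open>auto split: if_splits\<close>)
  qed
  then have "card {n \<in> {1..int N}. P n} \<le> card ((\<lambda>n. n + i) ` ?A \<union> ?B)"
    using finA by (intro card_mono) auto
  also have "\<dots> \<le> card ((\<lambda>n. n + i) ` ?A) + card ?B" by (rule card_Un_le)
  also have "card ((\<lambda>n. n + i) ` ?A) \<le> card ?A" by (rule card_image_le[OF finA])
  finally show ?thesis by (auto split: if_splits)
qed

text \<open>A double count: a point lying in \<open>s\<close> of the sets contributes
  \<open>s\<close> on the left and \<open>1 + s * (s - 1)\<close> on the right. Truncated
  subtraction is harmless at \<open>s = 0\<close>, where it is multiplied by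
  \<open>0\<close>.\<close>

lemma sum_card_le_card_pairs:
  fixes A :: "'i \<Rightarrow> 'b set"
  assumes "finite S" "finite X" "\<And>i. i \<in> S \<Longrightarrow> A i \<subseteq> X"
  shows "(\<Sum>i\<in>S. card (A i)) \<le> card X + (\<Sum>i\<in>S. \<Sum>j\<in>S-{i}. card (A i \<inter> A j))"
proof -
  define s where "s = (\<lambda>x. card {i\<in>S. x \<in> A i})"
  have fin: "finite (A i)" if "i \<in> S" for i using assms that by (meson finite_subset)
  have c: "card B = (\<Sum>x\<in>X. if x \<in> B then 1 else 0)" if "B \<subseteq> X" for B
    using that assms(2) by (simp add: sum.If_cases Int_absorb1)
  have 1: "(\<Sum>i\<in>S. card (A i)) = (\<Sum>x\<in>X. s x)"
  proof -
    have "(\<Sum>i\<in>S. card (A i)) = (\<Sum>i\<in>S. \<Sum>x\<in>X. if x \<in> A i then 1 else 0)"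
      using assms(3) by (intro sum.cong c) auto
    also have "\<dots> = (\<Sum>x\<in>X. \<Sum>i\<in>S. if x \<in> A i then 1 else 0)" by (rule sum.swap)
    finally show ?thesis using assms(1) by (simp add: s_def sum.If_cases Collect_conj_eq)
  qed
  have 2: "(\<Sum>i\<in>S. \<Sum>j\<in>S-{i}. card (A i \<inter> A j)) = (\<Sum>x\<in>X. s x * (s x - 1))"
  proof -
    have "(\<Sum>i\<in>S. \<Sum>j\<in>S-{i}. card (A i \<inter> A j))
      = (\<Sum>i\<in>S. \<Sum>j\<in>S-{i}. \<Sum>x\<in>X. if x \<in> A i \<inter> A j then 1 else 0)"
      using assms(3) by (intro sum.cong c refl) auto
    also have "\<dots> = (\<Sum>i\<in>S. \<Sum>x\<in>X. \<Sum>j\<in>S-{i}. if x \<in> A i \<inter> A j then 1 else 0)"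
      by (intro sum.cong sum.swap refl)
    also have "\<dots> = (\<Sum>x\<in>X. \<Sum>i\<in>S. \<Sum>j\<in>S-{i}. if x \<in> A i \<inter> A j then 1 else 0)"
      by (rule sum.swap)
    also have "\<dots> = (\<Sum>x\<in>X. s x * (s x - 1))"
    proof (intro sum.cong refl)
      fix x
      have "(\<Sum>i\<in>S. \<Sum>j\<in>S-{i}. if x \<in> A i \<inter> A j then 1 else 0)
        = (\<Sum>i\<in>S. if x \<in> A i then s x - 1 else 0)"
      proof (intro sum.cong refl)
        fix i assume i: "i \<in> S"
        show "(\<Sum>j\<in>S-{i}. if x \<in> A i \<inter> A j then 1 else 0) = (if x \<in> A i then s x - 1 else 0)"
        proof (cases "x \<in> A i")
          case True
          have "(\<Sum>j\<in>S-{i}. if x \<in> A i \<inter> A j then 1 else 0) = card ((S - {i}) \<inter> {j. x \<in> A j})"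
            using True assms(1) by (simp add: sum.If_cases)
          also have "(S - {i}) \<inter> {j. x \<in> A j} = {j\<in>S. x \<in> A j} - {i}" by auto
          also have "card \<dots> = s x - 1" using i True assms(1) by (simp add: s_def)
          finally show ?thesis using True by simp
        qed simp
      qed
      also have "\<dots> = s x * (s x - 1)"
        using assms(1) by (simp add: s_def sum.If_cases Collect_conj_eq)
      finally show "(\<Sum>i\<in>S. \<Sum>j\<in>S-{i}. if x \<in> A i \<inter> A j then 1 else 0) = s x * (s x - 1)" .
    qed
    finally show ?thesis .
  qed
  have 3: "(\<Sum>x\<in>X. s x) \<le> (\<Sum>x\<in>X. 1 + s x * (s x - 1))"
  proof (rule sum_mono)
    fix x show "s x \<le> 1 + s x * (s x - 1)"
      by (cases "s x") auto
  qed
  show ?thesis using 3 unfolding 1 2 sum.distrib by simp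
qed

text \<open>The hypothesis \<open>bound\<close> sees \<open>u\<close> only along differences of
  elements of \<open>E\<close>. Averaging weights \<open>u k\<close> by the density
  \<open>d k\<close> of returns after time \<open>k\<close>. Where this density is at least
  \<open>\<eta>\<close> the weight can be divided out, and the growth bound on \<open>u\<close>
  carries the estimate to all other integers.\<close>

lemma sums_bounded_if_return_sums_bounded:
  fixes u :: "int \<Rightarrow> real" and E :: "nat set"
  assumes u: "\<And>k. u k \<ge> 0"
    and c: "c \<ge> 1" "\<And>k. u (k + 1) \<le> c * u k" "\<And>k. u k \<le> c * u (k + 1)"
    and E: "positive_lower_density E"
    and bound: "\<And>n F. n \<in> E \<Longrightarrow> finite F \<Longrightarrow> F \<subseteq> E \<Longrightarrow> (\<Sum>m\<in>F. u (int m - int n)) \<le> C"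
  obtains B where "\<And>F. finite F \<Longrightarrow> sum u F \<le> B"
proof -
  \<comment> \<open>\<open>E\<close> is moved into the integers so that negative shifts do not
    truncate.\<close>
  define I where "I = int ` E"
  define cnt where "cnt k N = card {n \<in> {1..int N}. n \<in> I \<and> n + k \<in> I}" for k N
  have cnt_le: "cnt k N \<le> N" for k N
  proof -
    have "cnt k N \<le> card {1..int N}"
      unfolding cnt_def by (intro card_mono) auto
    then show ?thesis by simp
  qed
  obtain \<delta> where \<delta>: "\<delta> > 0" "\<forall>\<^sub>F N in sequentially. \<delta> * real N \<le> real (card (E \<inter> {1..N}))"
    using E unfolding positive_lower_density_def by blast
  have cardI: "card (E \<inter> {1..N}) = card {n \<in> {1..int N}. n \<in> I}" for N
  proof -
    have "{n \<in> {1..int N}. n \<in> I} = int ` (E \<inter> {1..N})" by (auto simp: I_def)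
    then show ?thesis by (simp add: card_image)
  qed
  \<comment> \<open>Limits along all \<open>N\<close> may fail to exist; one subsequence
    \<open>r\<close> serves every \<open>k\<close> at once. At \<open>N = 0\<close> the quotient is
    \<open>0\<close> by the convention on division.\<close>
  obtain r d where r: "strict_mono (r :: nat \<Rightarrow> nat)"
    and d: "\<And>k. (\<lambda>n. real (cnt k (r n)) / real (r n)) \<longlonglongrightarrow> d k"
    by (rule convergent_subsequence_pointwise[of "\<lambda>N k. real (cnt k N) / real N"])
       (use cnt_le in \<open>auto simp: divide_le_eq_1\<close>)
  have r_top: "filterlim r sequentially sequentially"
    using r by (rule filterlim_subseq)
  have r_pos: "\<forall>\<^sub>F n in sequentially. r n > 0"
    using eventually_compose_filterlim[OF eventually_gt_at_top r_top] .
  have inv0: "(\<lambda>n. x / real (r n)) \<longlonglongrightarrow> 0" for x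
    using filterlim_compose[OF lim_const_over_n[of x] r_top] by simp
  have d0: "d k \<ge> 0" for k
    by (rule tendsto_lowerbound[OF d]) auto
  \<comment> \<open>Reading a pair of returns from its other end shifts the window by
    \<open>k\<close>; the error of at most \<open>\<bar>k\<bar>\<close> disappears after division by
    \<open>r n\<close>.\<close>
  have d_sym_le: "d (-k) \<le> d k" for k
  proof (rule tendsto_le[OF _ _ d])
    show "(\<lambda>n. real (cnt k (r n)) / real (r n) + \<bar>k\<bar> / real (r n)) \<longlonglongrightarrow> d k"
      using tendsto_add[OF d inv0] by simp
    have "cnt (-k) N \<le> cnt k N + nat \<bar>k\<bar>" for N
    proof -
      have "{n \<in> {1..int N}. n + k \<in> I \<and> n + k + - k \<in> I} = {n \<in> {1..int N}. n \<in> I \<and> n + k \<in> I}"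
        by auto
      then show ?thesis
        using card_shift_le[where P = "\<lambda>n. n \<in> I \<and> n + -k \<in> I" and N = N and i = k]
        by (simp only: cnt_def)
    qed
    then have le: "real (cnt (-k) N) \<le> real (cnt k N) + real_of_int \<bar>k\<bar>" for N
      by (smt (verit) of_nat_add of_nat_le_iff of_nat_nat of_int_of_nat_eq)
    then show "\<forall>\<^sub>F n in sequentially. real (cnt (-k) (r n)) / real (r n)
        \<le> real (cnt k (r n)) / real (r n) + \<bar>k\<bar> / real (r n)"
    proof (intro always_eventually allI)
      fix n
      show "real (cnt (-k) (r n)) / real (r n) \<le> real (cnt k (r n)) / real (r n) + \<bar>k\<bar> / real (r n)"
        using divide_right_mono[OF le[of "r n"], of "real (r n)"] by (simp add: add_divide_distrib)
    qed
  qed simp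
  have d_sym: "d (-k) = d k" for k
    using d_sym_le[of k] d_sym_le[of "-k"] by simp
  have sum_d: "(\<Sum>k\<in>F. u k * d k) \<le> C" if "finite F" for F
  proof (rule tendsto_upperbound)
    show "(\<lambda>n. \<Sum>k\<in>F. u k * (real (cnt k (r n)) / real (r n))) \<longlonglongrightarrow> (\<Sum>k\<in>F. u k * d k)"
      by (intro tendsto_sum tendsto_mult d tendsto_const)
    have C0: "C \<ge> 0"
    proof -
      obtain n where "n \<in> E"
        using positive_lower_density_infinite[OF E] infinite_imp_nonempty by blast
      then show ?thesis using bound[of n "{}"] by simp
    qed
    \<comment> \<open>Both sides of the interchange count pairs \<open>n\<close>,
      \<open>n + k\<close> in \<open>I\<close>. For fixed \<open>n\<close> the inner sum runs over
      \<open>m = n + k\<close> in \<open>E\<close>, which is where \<open>bound\<close>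
      applies.\<close>
    have main: "(\<Sum>k\<in>F. u k * real (cnt k N)) \<le> C * real N" for N
    proof -
      let ?X = "{n \<in> {1..int N}. n \<in> I}"
      have finX: "finite ?X" by (rule finite_subset[of _ "{1..int N}"]) auto
      have "(\<Sum>k\<in>F. u k * real (cnt k N)) = (\<Sum>k\<in>F. \<Sum>n\<in>?X. if n + k \<in> I then u k else 0)"
      proof (intro sum.cong refl)
        fix k
        have "{n \<in> {1..int N}. n \<in> I \<and> n + k \<in> I} = ?X \<inter> {n. n + k \<in> I}" by auto
        then show "u k * real (cnt k N) = (\<Sum>n\<in>?X. if n + k \<in> I then u k else 0)"
          unfolding cnt_def sum.If_cases[OF finX] by simp
      qed
      also have "\<dots> = (\<Sum>n\<in>?X. \<Sum>k\<in>F. if n + k \<in> I then u k else 0)" by (rule sum.swap)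
      also have "\<dots> \<le> (\<Sum>n\<in>?X. C)"
      proof (rule sum_mono)
        fix n assume n: "n \<in> ?X"
        then obtain n' where n': "n = int n'" "n' \<in> E" by (auto simp: I_def)
        have "(\<Sum>k\<in>F. if n + k \<in> I then u k else 0) = (\<Sum>k\<in>F \<inter> {k. n + k \<in> I}. u k)"
          using \<open>finite F\<close> by (simp add: sum.If_cases)
        also have "\<dots> = (\<Sum>m\<in>(\<lambda>k. nat (n + k)) ` (F \<inter> {k. n + k \<in> I}). u (int m - int n'))"
        proof (subst sum.reindex)
          show "inj_on (\<lambda>k. nat (n + k)) (F \<inter> {k. n + k \<in> I})"
            by (auto simp: inj_on_def I_def)
        qed (auto simp: n' I_def intro!: sum.cong arg_cong[of _ _ u])
        also have "\<dots> \<le> C"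
          using n'(2) \<open>finite F\<close> by (intro bound) (auto simp: I_def)
        finally show "(\<Sum>k\<in>F. if n + k \<in> I then u k else 0) \<le> C" .
      qed
      also have "\<dots> = C * real (card ?X)" by simp
      also have "\<dots> \<le> C * real N"
      proof -
        have "card ?X \<le> card {1..int N}" by (intro card_mono) auto
        then show ?thesis using C0 by (intro mult_left_mono) auto
      qed
      finally show ?thesis .
    qed
    show "\<forall>\<^sub>F n in sequentially. (\<Sum>k\<in>F. u k * (real (cnt k (r n)) / real (r n))) \<le> C"
      using r_pos 
    proof eventually_elim
      case (elim n)
      then show ?case using main[of "r n"] by (simp add: pos_divide_le_eq flip: sum_divide_distrib)
    qed
  qed simp
  txt \<open>\<open>R\<close> translates of \<open>E\<close> have total density at least \<open>2\<close>, so two of them must meet with density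
    at least \<open>\<eta>\<close>. Thus \<open>\<eta>\<close>-separated sets have fewer than \<open>R\<close> elements, and a maximal one yields the
    covering by translates.\<close>
  define R where "R = Suc (nat \<lceil>2 / \<delta>\<rceil>)"
  have R: "R > 0" "real R * \<delta> \<ge> 2"
  proof -
    have "real R \<ge> 2 / \<delta>" unfolding R_def by linarith
    then show "real R * \<delta> \<ge> 2" using \<delta>(1) by (simp add: field_simps)
  qed (simp add: R_def)
  define \<eta> where "\<eta> = 1 / (2 * real R ^ 2)"
  have \<eta>: "\<eta> > 0" using R by (simp add: \<eta>_def)
  define sep where "sep S \<longleftrightarrow> finite S \<and> (\<forall>i\<in>S. \<forall>j\<in>S - {i}. d (j - i) < \<eta>)" for S
  have not_sep: "\<not> sep S" if "card S = R" for S
  proof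
    assume S: "sep S"
    then have "finite S" by (simp add: sep_def)
    have le: "real R * \<delta> \<le> 1 + (\<Sum>i\<in>S. \<Sum>j\<in>S-{i}. d (j - i))"
    proof (rule tendsto_le)
      let ?x = "(\<Sum>i\<in>S. real_of_int \<bar>i\<bar>) + (\<Sum>i\<in>S. \<Sum>j\<in>S-{i}. real_of_int \<bar>i\<bar>)"
      show "(\<lambda>n. 1 + (\<Sum>i\<in>S. \<Sum>j\<in>S-{i}. real (cnt (j - i) (r n)) / real (r n)) + ?x / real (r n))
        \<longlonglongrightarrow> 1 + (\<Sum>i\<in>S. \<Sum>j\<in>S-{i}. d (j - i))"
        using tendsto_add[OF tendsto_add[OF tendsto_const[of 1] tendsto_sum[OF tendsto_sum[OF d]]] inv0[of ?x]]
        by simp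
      show "(\<lambda>n. real R * \<delta>) \<longlonglongrightarrow> real R * \<delta>" by simp
      \<comment> \<open>The double count is applied to the traces of the translates of
        \<open>E\<close> on one window. All boundary errors are collected in \<open>?x\<close>,
        which is independent of \<open>N\<close> and so vanishes in the limit.\<close>
      have main: "real R * real (card (E \<inter> {1..N}))
        \<le> real N + (\<Sum>i\<in>S. \<Sum>j\<in>S-{i}. real (cnt (j - i) N)) + ?x" for N
      proof -
        let ?A = "\<lambda>i. {n \<in> {1..int N}. n + i \<in> I}"
        have 1: "real (card (E \<inter> {1..N})) \<le> real (card (?A i)) + real_of_int \<bar>i\<bar>" for i
          unfolding cardI using card_shift_le[where P = "\<lambda>n. n \<in> I" and N = N and i = i] by simp
        have 2: "real (card (?A i \<inter> ?A j)) \<le> real (cnt (j - i) N) + real_of_int \<bar>i\<bar>" for i j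
        proof -
          have eq: "?A i \<inter> ?A j = {n \<in> {1..int N}. n + i \<in> I \<and> n + j \<in> I}" by auto
          have "card (?A i \<inter> ?A j) \<le> cnt (j - i) N + nat \<bar>i\<bar>"
            unfolding eq cnt_def
            using card_shift_le[where P = "\<lambda>n. n + i \<in> I \<and> n + j \<in> I" and N = N and i = "- i"]
            by (simp add: algebra_simps)
          then show ?thesis by linarith
        qed
        have 3: "(\<Sum>i\<in>S. real (card (?A i))) \<le> real N + (\<Sum>i\<in>S. \<Sum>j\<in>S-{i}. real (card (?A i \<inter> ?A j)))"
        proof -
          have "(\<Sum>i\<in>S. card (?A i)) \<le> card {1..int N} + (\<Sum>i\<in>S. \<Sum>j\<in>S-{i}. card (?A i \<inter> ?A j))"
            using \<open>finite S\<close> by (intro sum_card_le_card_pairs) auto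
          then have "real (\<Sum>i\<in>S. card (?A i)) \<le> real (N + (\<Sum>i\<in>S. \<Sum>j\<in>S-{i}. card (?A i \<inter> ?A j)))"
            by (simp only: of_nat_le_iff card_atLeastAtMost_int)
          then show ?thesis by (simp only: of_nat_sum of_nat_add)
        qed
        have "real R * real (card (E \<inter> {1..N})) = (\<Sum>i\<in>S. real (card (E \<inter> {1..N})))"
          using that by simp
        also have "\<dots> \<le> (\<Sum>i\<in>S. real (card (?A i)) + real_of_int \<bar>i\<bar>)"
          by (intro sum_mono 1)
        also have "\<dots> \<le> real N + (\<Sum>i\<in>S. \<Sum>j\<in>S-{i}. real (cnt (j - i) N) + real_of_int \<bar>i\<bar>)
            + (\<Sum>i\<in>S. real_of_int \<bar>i\<bar>)"
        proof -
          have "(\<Sum>i\<in>S. \<Sum>j\<in>S-{i}. real (card (?A i \<inter> ?A j)))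
            \<le> (\<Sum>i\<in>S. \<Sum>j\<in>S-{i}. real (cnt (j - i) N) + real_of_int \<bar>i\<bar>)"
            by (intro sum_mono 2)
          then show ?thesis using 3 by (simp add: sum.distrib)
        qed
        finally show ?thesis by (simp only: sum.distrib)
      qed
      show "\<forall>\<^sub>F n in sequentially. real R * \<delta>
        \<le> 1 + (\<Sum>i\<in>S. \<Sum>j\<in>S-{i}. real (cnt (j - i) (r n)) / real (r n)) + ?x / real (r n)"
        using eventually_compose_filterlim[OF \<delta>(2) r_top] r_pos
      proof eventually_elim
        case (elim n)
        have "real R * \<delta> * real (r n) \<le> real R * real (card (E \<inter> {1..r n}))"
          using elim(1) by (simp add: mult.assoc mult_left_mono)
        also note main[of "r n"]
        finally have "real R * \<delta> \<le> (real (r n) + (\<Sum>i\<in>S. \<Sum>j\<in>S-{i}. real (cnt (j - i) (r n))) + ?x) / real (r n)"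
          using elim(2) by (simp add: pos_le_divide_eq)
        also have "\<dots> = 1 + (\<Sum>i\<in>S. \<Sum>j\<in>S-{i}. real (cnt (j - i) (r n)) / real (r n)) + ?x / real (r n)"
          using elim(2) by (simp add: add_divide_distrib sum_divide_distrib)
        finally show ?case .
      qed
    qed simp
    \<comment> \<open>This fixes the value of \<open>\<eta>\<close>: at most \<open>R ^ 2\<close>
      ordered pairs contribute at most \<open>1 / 2\<close>, so \<open>le\<close> would give
      \<open>R * \<delta> \<le> 3 / 2\<close>.\<close>
    have "(\<Sum>i\<in>S. \<Sum>j\<in>S-{i}. d (j - i)) \<le> (\<Sum>i\<in>S. \<Sum>j\<in>S-{i}. \<eta>)"
      using S by (intro sum_mono) (auto simp: sep_def less_imp_le)
    also have "\<dots> \<le> (\<Sum>i\<in>S. \<Sum>j\<in>S. \<eta>)"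
      using \<open>finite S\<close> \<eta> by (intro sum_mono sum_mono2) auto
    also have "\<dots> = 1 / 2" using that R(1) by (simp add: \<eta>_def power2_eq_square)
    finally show False using le R(2) by simp
  qed
  have sep_card: "card S < R" if S: "sep S" for S
  proof (rule ccontr)
    assume "\<not> card S < R"
    then obtain S' where "S' \<subseteq> S" "card S' = R"
      by (meson not_less obtain_subset_with_card_n)
    moreover from this S have "sep S'" unfolding sep_def by (auto intro: finite_subset)
    ultimately show False using not_sep by blast
  qed
  have "sep {}" by (simp add: sep_def)
  then obtain S where S: "sep S" and S_max: "\<And>S'. sep S' \<Longrightarrow> card S' \<le> card S"
    using ex_has_greatest_nat[of sep "{}" card R] sep_card by (metis less_imp_le)
  have finS: "finite S" using S by (simp add: sep_def)
  \<comment> \<open>\<open>0\<close> is included by hand so that each element of \<open>S\<close>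
    covers itself; this costs only the term \<open>u 0\<close> in \<open>sumD\<close>.\<close>
  define D where "D = {k. k = 0 \<or> d k \<ge> \<eta>}"
  \<comment> \<open>By maximality, adding \<open>k\<close> to \<open>S\<close> destroys separation,
    and an offending pair must involve \<open>k\<close>. The symmetry of \<open>d\<close> settles
    the order within the pair.\<close>
  have cover: "\<exists>s\<in>S. k - s \<in> D" for k
  proof (cases "k \<in> S")
    case False
    then have "\<not> sep (insert k S)"
      using S_max[of "insert k S"] finS by auto
    then obtain i j where ij: "i \<in> insert k S" "j \<in> insert k S" "i \<noteq> j" "d (j - i) \<ge> \<eta>"
      using finS unfolding sep_def by (auto simp: not_less)
    have "\<not> (i \<in> S \<and> j \<in> S)" using S ij unfolding sep_def by force
    then consider "j = k" "i \<in> S" | "i = k" "j \<in> S" using ij by auto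
    then show ?thesis
    proof cases
      case 2
      then show ?thesis using ij(4) d_sym[of "j - i"] by (auto simp: D_def intro!: bexI[of _ j])
    qed (use ij in \<open>auto simp: D_def\<close>)
  qed (auto simp: D_def)
  have sumD: "sum u F \<le> u 0 + C / \<eta>" if "finite F" "F \<subseteq> D" for F
  proof -
    have "sum u F \<le> u 0 + sum u (F - {0})"
    proof (cases "0 \<in> F")
      case True
      then show ?thesis using sum.remove[OF \<open>finite F\<close>, of 0 u] by simp
    qed (simp add: u)
    also have "sum u (F - {0}) \<le> (\<Sum>k\<in>F-{0}. u k * d k / \<eta>)"
    proof (rule sum_mono)
      fix k assume "k \<in> F - {0}"
      then have "d k \<ge> \<eta>" using that by (auto simp: D_def)
      then have "u k * \<eta> \<le> u k * d k" using u by (intro mult_left_mono)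
      then show "u k \<le> u k * d k / \<eta>" using \<eta> by (simp add: field_simps)
    qed
    also have "\<dots> \<le> C / \<eta>"
      using sum_d[of "F - {0}"] \<open>finite F\<close> \<eta> by (simp add: divide_right_mono flip: sum_divide_distrib)
    finally show ?thesis by simp
  qed
  have shift: "u (k + s) \<le> c ^ nat \<bar>s\<bar> * u k" for k s
  proof -
    have "u (k + int n) \<le> c ^ n * u k \<and> u (k - int n) \<le> c ^ n * u k" for n
    proof (induction n)
      case (Suc n)
      have "u (k + int (Suc n)) \<le> c * u (k + int n)"
        using c(2)[of "k + int n"] by (simp add: algebra_simps)
      moreover have "u (k - int (Suc n)) \<le> c * u (k - int n)"
        using c(3)[of "k - int (Suc n)"] by (simp add: algebra_simps)
      moreover have "c * u (k + int n) \<le> c ^ Suc n * u k" "c * u (k - int n) \<le> c ^ Suc n * u k"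
        using Suc c(1) by (simp_all add: mult.assoc)
      ultimately show ?case by linarith
    qed simp
    from this[of "nat \<bar>s\<bar>"] show ?thesis by (cases "s \<ge> 0") auto
  qed
  show thesis
  proof (rule that[of "\<Sum>s\<in>S. c ^ nat \<bar>s\<bar> * (u 0 + C / \<eta>)"])
    fix F :: "int set" assume F: "finite F"
    \<comment> \<open>Each \<open>k\<close> is charged to every translate of \<open>D\<close> by an
      element of \<open>S\<close> that contains it, and there is at least one. Moving back by
      \<open>s\<close> costs the factor in the witness.\<close>
    have "sum u F \<le> (\<Sum>k\<in>F. \<Sum>s\<in>S. if k - s \<in> D then u k else 0)"
    proof (rule sum_mono)
      fix k
      obtain s where s: "s \<in> S" "k - s \<in> D" using cover by blast
      have "(if k - s \<in> D then u k else 0) \<le> (\<Sum>s\<in>S. if k - s \<in> D then u k else 0)"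
        using finS s u by (intro member_le_sum) auto
      then show "u k \<le> (\<Sum>s\<in>S. if k - s \<in> D then u k else 0)" using s by simp
    qed
    also have "\<dots> = (\<Sum>s\<in>S. \<Sum>k\<in>F. if k - s \<in> D then u k else 0)" by (rule sum.swap)
    also have "\<dots> \<le> (\<Sum>s\<in>S. c ^ nat \<bar>s\<bar> * (u 0 + C / \<eta>))"
    proof (rule sum_mono)
      fix s
      have "(\<Sum>k\<in>F. if k - s \<in> D then u k else 0) = (\<Sum>k\<in>F \<inter> {k. k - s \<in> D}. u k)"
        using F by (simp add: sum.If_cases)
      also have "\<dots> \<le> (\<Sum>k\<in>F \<inter> {k. k - s \<in> D}. c ^ nat \<bar>s\<bar> * u (k - s))"
        using shift[of "k - s" s for k] by (intro sum_mono) simp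
      also have "\<dots> = c ^ nat \<bar>s\<bar> * (\<Sum>k\<in>(\<lambda>k. k - s) ` (F \<inter> {k. k - s \<in> D}). u k)"
        by (subst sum.reindex) (auto simp: inj_on_def sum_distrib_left)
      also have "\<dots> \<le> c ^ nat \<bar>s\<bar> * (u 0 + C / \<eta>)"
        using c(1) F by (intro mult_left_mono sumD) auto
      finally show "(\<Sum>k\<in>F. if k - s \<in> D then u k else 0) \<le> c ^ nat \<bar>s\<bar> * (u 0 + C / \<eta>)" .
    qed
    finally show "sum u F \<le> (\<Sum>s\<in>S. c ^ nat \<bar>s\<bar> * (u 0 + C / \<eta>))" .
  qed
qed

section \<open>Construction of separated sets of positive lower density\<close>

lemma int_image_Collect: "int ` {i \<in> {1..n}. Q (int i)} = {j \<in> {1..int n}. Q j}"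
proof (intro equalityI subsetI)
  fix j assume "j \<in> {j \<in> {1..int n}. Q j}"
  then show "j \<in> int ` {i \<in> {1..n}. Q (int i)}"
    by (intro rev_image_eqI[of "nat j"]) auto
qed auto

text \<open>The bad residues sit at the end of each period, so the count is exact, without a boundary term:
  shifting the bad elements down by multiples of \<open>\<Gamma>\<close> stays inside \<open>{1..n}\<close>.\<close>

lemma card_residue_block:
  fixes \<Gamma> :: int
  assumes "\<Gamma> > 0" "R > 0"
  shows "card {i \<in> {1..int n}. (- i) mod (\<Gamma> * int R) < \<Gamma>} * R \<le> n"
proof -
  let ?Q = "\<Gamma> * int R" and ?B = "{i \<in> {1..int n}. (- i) mod (\<Gamma> * int R) < \<Gamma>}"
  have Q: "?Q > 0" using assms by simp
  let ?f = "\<lambda>(i, t). i - int t * \<Gamma>"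
  have eq: "(- (i - int t * \<Gamma>)) mod ?Q = (- i) mod ?Q + int t * \<Gamma>"
    if "i \<in> ?B" "t < R" for i t
  proof -
    have "int t * \<Gamma> \<le> (int R - 1) * \<Gamma>"
      using that(2) assms by (intro mult_right_mono) auto
    then have "(- i) mod ?Q + int t * \<Gamma> < ?Q"
      using that(1) by (auto simp: algebra_simps)
    moreover have "(- i) mod ?Q + int t * \<Gamma> \<ge> 0"
      using Q assms by simp
    ultimately have "((- i) mod ?Q + int t * \<Gamma>) mod ?Q = (- i) mod ?Q + int t * \<Gamma>"
      by (intro mod_pos_pos_trivial)
    moreover have "((- i) mod ?Q + int t * \<Gamma>) mod ?Q = (- (i - int t * \<Gamma>)) mod ?Q"
      by (simp add: mod_add_left_eq)
    ultimately show ?thesis by simp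
  qed
  have "card (?B \<times> {..<R}) \<le> card {1..int n}"
  proof (rule card_inj_on_le)
    show "inj_on ?f (?B \<times> {..<R})"
    proof (rule inj_onI, clarsimp simp del: of_nat_mult)
      fix i t j s
      assume ij: "1 \<le> i" "i \<le> int n" "(- i) mod ?Q < \<Gamma>" "1 \<le> j" "j \<le> int n" "(- j) mod ?Q < \<Gamma>"
        and ts: "t < R" "s < R" and e: "i - int t * \<Gamma> = j - int s * \<Gamma>"
      have "(- i) mod ?Q + int t * \<Gamma> = (- j) mod ?Q + int s * \<Gamma>"
        using eq[of i t] eq[of j s] e ij ts by simp
      then have "((- i) mod ?Q + int t * \<Gamma>) div \<Gamma> = ((- j) mod ?Q + int s * \<Gamma>) div \<Gamma>"
        by simp
      moreover have "((- i) mod ?Q) div \<Gamma> = 0" "((- j) mod ?Q) div \<Gamma> = 0"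
        using ij Q by (simp_all add: div_pos_pos_trivial)
      ultimately have "t = s" using assms by simp
      then show "i = j \<and> t = s" using e by simp
    qed
    show "?f ` (?B \<times> {..<R}) \<subseteq> {1..int n}"
    proof clarsimp
      fix i t assume i: "1 \<le> i" "i \<le> int n" "(- i) mod ?Q < \<Gamma>" and t: "t < R"
      have "i + (- i) mod ?Q = - ((- i) div ?Q * ?Q)"
        using div_mult_mod_eq[of "- i" ?Q] by linarith
      moreover have "(- i) mod ?Q \<ge> 0" using Q by simp
      ultimately have "0 < - ((- i) div ?Q) * ?Q" using i by simp
      then have "0 < - ((- i) div ?Q)" using Q by (metis zero_less_mult_pos2)
      then have "1 \<le> - ((- i) div ?Q)" by linarith
      then have "1 * ?Q \<le> - ((- i) div ?Q) * ?Q" using Q by (intro mult_right_mono) auto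
      moreover have "(- i) mod ?Q + int t * \<Gamma> < ?Q"
        using eq[of i t] i t Q by (metis (no_types, lifting) atLeastAtMost_iff mem_Collect_eq pos_mod_bound)
      ultimately have "i - int t * \<Gamma> \<ge> 1"
        using \<open>i + (- i) mod ?Q = - ((- i) div ?Q * ?Q)\<close> by linarith
      moreover have "int t * \<Gamma> \<ge> 0" using assms by simp
      ultimately show "1 \<le> i - int t * \<Gamma> \<and> i - int t * \<Gamma> \<le> int n" using i by linarith
    qed
  qed simp
  then show ?thesis by (simp add: card_cartesian_product)
qed

text \<open>The sets come from multiples of periods that form a divisibility chain. Two points of
  different index can then only be too close just to the left of a multiple of the larger period.
  Deleting such points costs a proportion \<open>1 / 2 ^ (m + 2)\<close> for the period of index
  \<open>m\<close>, and these proportions sum to at most one half.\<close>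

lemma separated_positive_density_sets:
  fixes g :: "nat \<Rightarrow> nat"
  assumes g: "\<And>l. g l > 0"
  obtains A :: "nat \<Rightarrow> nat set" where
    "\<And>l. positive_lower_density (A l)"
    "\<And>l n. n \<in> A l \<Longrightarrow> g l \<le> n"
    "\<And>l l' n n'. n \<in> A l \<Longrightarrow> n' \<in> A l' \<Longrightarrow> (l, n) \<noteq> (l', n') \<Longrightarrow>
       int (g l) + int (g l') \<le> \<bar>int n - int n'\<bar>"
proof -
  \<comment> \<open>The recursion amounts to \<open>q l = 2 ^ (l + 2) * G l\<close>: the length
    \<open>G l\<close> is at least \<open>2 * g l\<close> and a multiple of all earlier periods, and
    the power of two makes the deleted proportions summable.\<close>
  define q :: "nat \<Rightarrow> nat" where
    "q = rec_nat (4 * (2 * g 0)) (\<lambda>l x. 2 ^ (l + 3) * (2 * g (Suc l) * x))"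
  define G where "G l = (case l of 0 \<Rightarrow> 2 * g 0 | Suc k \<Rightarrow> 2 * g (Suc k) * q k)" for l
  have q: "q l = 2 ^ (l + 2) * G l" for l
    by (cases l) (simp_all add: q_def G_def power_add)
  have qpos: "q l > 0" for l
    by (induction l) (simp_all add: q_def g)
  have Gpos: "G l > 0" for l using qpos[of l] by (simp add: q)
  have qG: "q k dvd G (Suc k)" for k by (simp add: G_def)
  have qq: "q l dvd q m" if "l \<le> m" for l m
    using that
  proof (induction m rule: dec_induct)
    case (step m)
    have "q m dvd q (Suc m)" using qG[of m] by (simp add: q)
    then show ?case using step by (meson dvd_trans)
  qed simp
  have qdvdG: "q l dvd G m" if "l < m" for l m
  proof -
    obtain k where "m = Suc k" "l \<le> k" using \<open>l < m\<close> by (cases m) auto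
    then show ?thesis using qq[of l k] qG[of k] by (metis dvd_trans)
  qed
  have G_ge: "G l \<ge> 2 * g l" for l
  proof (cases l)
    case (Suc k)
    have "2 * g (Suc k) * 1 \<le> 2 * g (Suc k) * q k"
      using qpos[of k] by (intro mult_left_mono) auto
    then show ?thesis using Suc by (simp add: G_def)
  qed (simp add: G_def)
  have q_ge: "q l \<ge> 2 * g l" for l
  proof -
    have "1 * G l \<le> 2 ^ (l + 2) * G l" by (intro mult_right_mono) auto
    then have "G l \<le> q l" by (simp only: q mult_1)
    then show ?thesis using G_ge[of l] by linarith
  qed
  txt \<open>\<open>s \<in> S l\<close> is the right end of a block of length \<open>2 * g l\<close> ending at a multiple of \<open>q l\<close>; it is
    discarded when it lies within \<open>G m\<close> to the left of a multiple of some \<open>q m\<close> with \<open>m > l\<close>. Since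
    \<open>q m = 2 ^ (m + 2) * G m\<close>, at most half of the blocks are lost.\<close>
  define S where "S l = {s::nat. s \<ge> 1 \<and> q l dvd s \<and> (\<forall>m>l. (- int s) mod int (q m) \<ge> int (G m))}" for l
  have S_ge: "s \<ge> q l" if "s \<in> S l" for s l
    using that by (auto simp: S_def intro!: dvd_imp_le)
  \<comment> \<open>If \<open>s \<le> s'\<close>, the deletion rule gives a gap of at least
    \<open>G l'\<close>, hence \<open>2 * g l'\<close>. If \<open>s > s'\<close>, both are multiples
    of \<open>q l\<close>, so the gap is at least \<open>2 * g l\<close>. Passing from right ends to
    centres changes either bound into \<open>g l + g l'\<close>.\<close>
  have gap_less: "int (g l) + int (g l') \<le> \<bar>(int s - int (g l)) - (int s' - int (g l'))\<bar>"
    if s: "s \<in> S l" "s' \<in> S l'" "l < l'" for s s' l l'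
  proof (cases "s \<le> s'")
    case True
    have "int (q l') dvd int s'" using s by (auto simp: S_def)
    then have "(- int s) mod int (q l') = (int s' - int s) mod int (q l')"
      by (metis diff_0 dvd_imp_mod_0 mod_diff_left_eq)
    also have "\<dots> \<le> int s' - int s" using True by (intro zmod_le_nonneg_dividend) simp
    finally have "int (G l') \<le> int s' - int s" using s by (force simp: S_def)
    then show ?thesis using G_ge[of l'] by linarith
  next
    case False
    have "q l dvd s" "q l dvd s'" using s qq[of l l'] by (auto simp: S_def intro: dvd_trans)
    then have "q l dvd s - s'" by simp
    then have "q l \<le> s - s'" using False by (intro dvd_imp_le) auto
    then show ?thesis using q_ge[of l] False by linarith
  qed
  have gap_eq: "int (g l) + int (g l) \<le> \<bar>(int s - int (g l)) - (int s' - int (g l))\<bar>"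
    if s: "s \<in> S l" "s' \<in> S l" "s < s'" for s s' l
  proof -
    have "q l dvd s' - s" using s by (auto simp: S_def)
    then have "q l \<le> s' - s" using s by (intro dvd_imp_le) auto
    then show ?thesis using q_ge[of l] s by linarith
  qed
  \<comment> \<open>The centres of the retained blocks.\<close>
  define A where "A l = (\<lambda>s. s - g l) ` S l" for l
  show thesis
  proof (rule that[of A])
    fix l n assume "n \<in> A l"
    then obtain s where s: "s \<in> S l" "n = s - g l" by (auto simp: A_def)
    then show "g l \<le> n" using S_ge[of s l] q_ge[of l] by linarith
  next
    fix l l' n n' assume n: "n \<in> A l" "n' \<in> A l'" "(l, n) \<noteq> (l', n')"
    obtain s where s: "s \<in> S l" "n = s - g l" using n by (auto simp: A_def)
    obtain s' where s': "s' \<in> S l'" "n' = s' - g l'" using n by (auto simp: A_def)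
    have i: "int n = int s - int (g l)" "int n' = int s' - int (g l')"
      using s s' S_ge[of s l] S_ge[of s' l'] q_ge[of l] q_ge[of l'] by auto
    consider "l < l'" | "l' < l" | "l = l'" "s < s'" | "l = l'" "s' < s"
      using n s s' by (metis linorder_neqE_nat)
    then show "int (g l) + int (g l') \<le> \<bar>int n - int n'\<bar>"
    proof cases
      case 1 then show ?thesis using gap_less[OF s(1) s'(1)] i by simp
    next
      case 2 then show ?thesis using gap_less[OF s'(1) s(1)] i by linarith
    next
      case 3 then show ?thesis using gap_eq[of s l s'] s s' i by simp
    next
      case 4 then show ?thesis using gap_eq[of s' l s] s s' i by (simp add: abs_minus_commute)
    qed
  next
    fix l
    have count: "real n / 2 \<le> real (card {i \<in> {1..n}. q l * i \<in> S l})" for n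
    proof -
      define Bad where "Bad m = {i \<in> {1..n}. (- int (q l * i)) mod int (q m) < int (G m)}" for m
      \<comment> \<open>Since \<open>q l\<close> divides \<open>G m\<close>, dividing by
        \<open>q l\<close> turns the condition into one on residues of \<open>i\<close> modulo
        \<open>2 ^ (m + 2)\<close> stretches of length \<open>\<Gamma>\<close>, of which one is
        bad.\<close>
      have bad: "real (card (Bad m)) \<le> real n / 2 ^ (m + 2)" if "l < m" for m
      proof -
        obtain \<Gamma> where \<Gamma>: "G m = q l * \<Gamma>" using qdvdG[OF \<open>l < m\<close>] by (auto elim: dvdE)
        have \<Gamma>pos: "\<Gamma> > 0" using Gpos[of m] \<Gamma> by simp
        have "(- int (q l * i)) mod int (q m) < int (G m) \<longleftrightarrow>
          (- int i) mod (int \<Gamma> * int (2 ^ (m + 2))) < int \<Gamma>" for i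
        proof -
          have "(- int (q l * i)) mod int (q m)
            = (int (q l) * (- int i)) mod (int (q l) * (int \<Gamma> * int (2 ^ (m + 2))))"
            by (simp add: q[of m] \<Gamma> mult_ac)
          also have "\<dots> = int (q l) * ((- int i) mod (int \<Gamma> * int (2 ^ (m + 2))))"
            by (rule mod_mult_mult1)
          finally show ?thesis using qpos[of l] \<Gamma> by simp
        qed
        then have "Bad m = {i \<in> {1..n}. (- int i) mod (int \<Gamma> * int (2 ^ (m + 2))) < int \<Gamma>}"
          unfolding Bad_def by simp
        then have "card (Bad m) = card {i \<in> {1..int n}. (- i) mod (int \<Gamma> * int (2 ^ (m + 2))) < int \<Gamma>}"
          using card_image[of int, OF inj_on_of_nat, of "{i \<in> {1..n}. (- int i) mod (int \<Gamma> * int (2 ^ (m + 2))) < int \<Gamma>}"]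
          by (simp only: int_image_Collect[of n "\<lambda>j. (- j) mod (int \<Gamma> * int (2 ^ (m + 2))) < int \<Gamma>"])
        then have "card (Bad m) * 2 ^ (m + 2) \<le> n"
          using card_residue_block[of "int \<Gamma>" "2 ^ (m + 2)" n] \<Gamma>pos by simp
        then have "real (card (Bad m) * 2 ^ (m + 2)) \<le> real n"
          by (simp only: of_nat_le_iff)
        then have "real (card (Bad m)) * 2 ^ (m + 2) \<le> real n" by simp
        then show ?thesis by (simp add: field_simps)
      qed
      \<comment> \<open>A count bounded by a number below \<open>1\<close> is zero. Hence only
        finitely many of the infinitely many deletion conditions affect
        \<open>{1..n}\<close>.\<close>
      have bad_empty: "Bad m = {}" if "l < m" "n < m" for m
      proof -
        have "m < 2 ^ m" by (rule less_exp)
        then have "n < 4 * 2 ^ m" using that(2) by linarith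
        then have "n < 2 ^ (m + 2)" by (simp add: power_add)
        then have "real n < real (2 ^ (m + 2))" by (simp only: of_nat_less_iff)
        then have "real n / 2 ^ (m + 2) < 1" by simp
        then have "real (card (Bad m)) < 1"
          using bad[OF that(1)] by linarith
        moreover have "finite (Bad m)" by (simp add: Bad_def)
        ultimately show ?thesis by simp
      qed
      have "{1..n} \<subseteq> {i \<in> {1..n}. q l * i \<in> S l} \<union> (\<Union>m\<in>{l<..n}. Bad m)"
      proof
        fix i assume i: "i \<in> {1..n}"
        show "i \<in> {i \<in> {1..n}. q l * i \<in> S l} \<union> (\<Union>m\<in>{l<..n}. Bad m)"
        proof (cases "q l * i \<in> S l")
          case False
          then obtain m where m: "m > l" "(- int (q l * i)) mod int (q m) < int (G m)"
            using i qpos[of l] by (auto simp: S_def not_le)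
          then have "i \<in> Bad m" using i by (simp add: Bad_def)
          moreover from this have "m \<le> n" using bad_empty[OF m(1)] by (cases "m \<le> n") auto
          ultimately show ?thesis using m by auto
        qed (use i in auto)
      qed
      then have "card {1..n} \<le> card ({i \<in> {1..n}. q l * i \<in> S l} \<union> (\<Union>m\<in>{l<..n}. Bad m))"
        by (intro card_mono) (auto simp: Bad_def)
      also have "\<dots> \<le> card {i \<in> {1..n}. q l * i \<in> S l} + (\<Sum>m\<in>{l<..n}. card (Bad m))"
        by (intro order_trans[OF card_Un_le] add_left_mono card_UN_le) simp
      finally have "real n \<le> real (card {i \<in> {1..n}. q l * i \<in> S l}) + (\<Sum>m\<in>{l<..n}. real (card (Bad m)))"
        by (simp flip: of_nat_sum of_nat_add)
      also have "(\<Sum>m\<in>{l<..n}. real (card (Bad m))) \<le> (\<Sum>m\<in>{l<..n}. real n / 4 * (1 / 2) ^ m)"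
        using bad by (intro sum_mono) (force simp: power_add field_simps)
      also have "\<dots> \<le> (\<Sum>m<Suc n. real n / 4 * (1 / 2) ^ m)"
        by (intro sum_mono2) auto
      also have "\<dots> = real n / 4 * (\<Sum>m<Suc n. (1 / 2) ^ m)"
        by (simp only: sum_distrib_left)
      also have "\<dots> \<le> real n / 4 * 2"
        unfolding sum_gp_strict by (intro mult_left_mono) auto
      finally show ?thesis by simp
    qed
    \<comment> \<open>For \<open>N \<ge> 2 * q l\<close> rounding down in \<open>N div q l\<close>
      costs at most a factor \<open>2\<close>, and the deletions another factor \<open>2\<close>;
      the constant \<open>8\<close> leaves room.\<close>
    have "real N / (8 * real (q l)) \<le> real (card (A l \<inter> {1..N}))" if "N \<ge> 2 * q l" for N
    proof -
      let ?n = "N div q l"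
      have "real N < real (q l) * (real ?n + 1)"
        using qpos[of l] dividend_less_times_div[of "q l" N]
        by (simp add: distrib_left flip: of_nat_mult of_nat_add of_nat_Suc)
      moreover have "?n \<ge> 2" using that qpos[of l] by (simp add: less_eq_div_iff_mult_less_eq)
      then have "real (q l) * (real ?n + 1) \<le> real (q l) * (2 * real ?n)"
        by (intro mult_left_mono) auto
      ultimately have "real N \<le> real (q l) * (2 * real ?n)" by linarith
      then have "real N / (8 * real (q l)) \<le> real ?n / 2"
        using qpos[of l] by (simp add: field_simps)
      also note count
      also have "card {i \<in> {1..?n}. q l * i \<in> S l} \<le> card (A l \<inter> {1..N})"
      proof (rule card_inj_on_le)
        have big: "q l * i \<ge> 2 * g l" if "i \<ge> 1" for i
          using q_ge[of l] that by (metis mult.right_neutral mult_le_mono2 order_trans)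
        show "inj_on (\<lambda>i. q l * i - g l) {i \<in> {1..?n}. q l * i \<in> S l}"
        proof (rule inj_onI)
          fix i j assume "i \<in> {i \<in> {1..?n}. q l * i \<in> S l}" "j \<in> {i \<in> {1..?n}. q l * i \<in> S l}"
            and e: "q l * i - g l = q l * j - g l"
          then have "2 * g l \<le> q l * i" "2 * g l \<le> q l * j" by (auto intro: big)
          with e have "q l * i = q l * j" by linarith
          then show "i = j" using qpos[of l] by simp
        qed
        show "(\<lambda>i. q l * i - g l) ` {i \<in> {1..?n}. q l * i \<in> S l} \<subseteq> A l \<inter> {1..N}"
        proof clarify
          fix i assume i: "i \<in> {1..?n}" "q l * i \<in> S l"
          have "q l * i \<le> q l * ?n" using i by simp
          also have "\<dots> \<le> N" by simp
          finally show "q l * i - g l \<in> A l \<inter> {1..N}"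
            using i big[of i] g[of l] by (auto simp: A_def)
        qed
      qed simp
      finally show ?thesis by simp
    qed
    then have "\<forall>\<^sub>F N in sequentially. 1 / (8 * real (q l)) * real N \<le> real (card (A l \<inter> {1..N}))"
      unfolding eventually_sequentially by (intro exI[of _ "2 * q l"]) simp
    then show "positive_lower_density (A l)"
      unfolding positive_lower_density_def using qpos[of l]
      by (intro exI[of _ "1 / (8 * real (q l))"]) simp
  qed
qed

section \<open>Dynamics of composition operators\<close>

text \<open>Frequent hypercyclicity for representatives and norm balls, so that functions can be
  constructed and estimated without passing through classes.\<close>

definition fhc_function ::
  "'a measure \<Rightarrow> real \<Rightarrow> ('a \<Rightarrow> 'a)
     \<Rightarrow> ('a \<Rightarrow> 'k::{real_normed_field,banach,second_countable_topology}) \<Rightarrow> bool" where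
  "fhc_function M p f \<phi> \<longleftrightarrow> \<phi> \<in> Lp_functions M p \<and>
     (\<forall>u\<in>Lp_functions M p. \<forall>\<epsilon>>0.
        positive_lower_density {n. Lp_norm M p (\<lambda>x. \<phi> ((f ^^ n) x) - u x) < \<epsilon>})"

lemma topspace_Lp: "p \<ge> 1 \<Longrightarrow> topspace (Lp_topology M p) = Lp_space M p"
  unfolding Lp_topology_def by (simp add: Metric_space.topspace_mtopology Metric_space_Lp)

lemma Lp_class_in_space: "g \<in> Lp_functions M p \<Longrightarrow> Lp_rel M p `` {g} \<in> Lp_space M p"
  by (simp add: Lp_space_def quotientI)

lemma Lp_spaceE:
  assumes "A \<in> Lp_space M p"
  obtains g where "g \<in> Lp_functions M p" "A = Lp_rel M p `` {g}"
  using assms by (auto simp: Lp_space_def elim!: quotientE)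

context measurable_system
begin

lemma iterate_in_Lp_functions:
  "g \<in> Lp_functions M p \<Longrightarrow> (\<lambda>x. g ((f ^^ n) x)) \<in> Lp_functions M p"
proof (induction n)
  case (Suc n)
  then show ?case
    using Lp_functions_compose[of "\<lambda>x. g ((f ^^ n) x)" p] by (simp add: comp_def funpow_swap1)
qed simp

lemma composition_operator_iterate:
  fixes g :: "'a \<Rightarrow> 'k::{real_normed_field,banach,second_countable_topology}"
  assumes "g \<in> Lp_functions M p"
  shows "(composition_operator M p f ^^ n) (Lp_rel M p `` {g}) = Lp_rel M p `` {\<lambda>x. g ((f ^^ n) x)}"
proof (induction n)
  case (Suc n)
  have "(composition_operator M p f ^^ Suc n) (Lp_rel M p `` {g})
    = composition_operator M p f (Lp_rel M p `` {\<lambda>x. g ((f ^^ n) x)})"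
    using Suc by simp
  also have "\<dots> = Lp_rel M p `` {(\<lambda>x. g ((f ^^ n) x)) \<circ> f}"
    by (intro composition_operator_class iterate_in_Lp_functions assms)
  finally show ?case by (simp add: comp_def funpow_swap1)
qed simp

lemma composition_operator_in_space:
  assumes "A \<in> Lp_space M p"
  shows "composition_operator M p f A \<in> Lp_space M p"
  using assms by (elim Lp_spaceE) (simp add: composition_operator_class Lp_class_in_space Lp_functions_compose)

text \<open>Every nonempty open set contains a ball about one of its points, and the distance from
  an iterate of a class to the centre is the norm of a difference of representatives.\<close>

lemma frequently_hypercyclic_iff_function:
  assumes p: "p \<ge> 1"
  shows "frequently_hypercyclic
      (Lp_topology M p :: ('a \<Rightarrow> 'k::{real_normed_field,banach,second_countable_topology}) set topology)
      (composition_operator M p f) \<longleftrightarrow>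
    (\<exists>\<phi> :: 'a \<Rightarrow> 'k. fhc_function M p f \<phi>)"
proof -
  let ?T = "composition_operator M p f :: ('a \<Rightarrow> 'k) set \<Rightarrow> _" and ?L = "Lp_topology M p :: ('a \<Rightarrow> 'k) set topology"
  let ?cl = "\<lambda>g :: 'a \<Rightarrow> 'k. Lp_rel M p `` {g}"
  interpret Lp: Metric_space "Lp_space M p :: ('a \<Rightarrow> 'k) set set" "Lp_dist M p"
    by (rule Metric_space_Lp[OF p])
  have dist: "Lp_dist M p (?cl u) ((?T ^^ n) (?cl \<phi>)) = Lp_norm M p (\<lambda>x. \<phi> ((f ^^ n) x) - u x)"
    if "u \<in> Lp_functions M p" "\<phi> \<in> Lp_functions M p" for u \<phi> n
    using that by (simp add: composition_operator_iterate Lp_dist_class iterate_in_Lp_functions Lp.commute)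
      (simp add: Lp_norm_def norm_minus_commute)
  have "(\<forall>U. openin ?L U \<and> U \<noteq> {} \<longrightarrow>
          0 < liminf (\<lambda>N. ereal (real (card {n \<in> {1..N}. (?T ^^ n) (?cl \<phi>) \<in> U}) / real N)))
    \<longleftrightarrow> fhc_function M p f \<phi>" (is "?l \<longleftrightarrow> ?r") if \<phi>: "\<phi> \<in> Lp_functions M p" for \<phi>
  proof
    assume l: ?l
    show ?r unfolding fhc_function_def
    proof (intro conjI ballI allI impI \<phi>)
      fix u :: "'a \<Rightarrow> 'k" and \<epsilon> :: real assume u: "u \<in> Lp_functions M p" "\<epsilon> > 0"
      have "openin ?L (Lp.mball (?cl u) \<epsilon>)" unfolding Lp_topology_def by simp
      moreover have "?cl u \<in> Lp.mball (?cl u) \<epsilon>" using u by (simp add: Lp_class_in_space)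
      ultimately have "positive_lower_density {n. (?T ^^ n) (?cl \<phi>) \<in> Lp.mball (?cl u) \<epsilon>}"
        using l unfolding positive_lower_density_iff_liminf by blast
      then show "positive_lower_density {n. Lp_norm M p (\<lambda>x. \<phi> ((f ^^ n) x) - u x) < \<epsilon>}"
        by (rule positive_lower_density_mono) (use dist[OF u(1) \<phi>] in auto)
    qed
  next
    assume r: ?r
    show ?l
    proof (intro allI impI)
      fix U assume U: "openin ?L U \<and> U \<noteq> {}"
      then obtain A where A: "A \<in> U" by blast
      then have "A \<in> Lp_space M p" using U openin_subset topspace_Lp[OF p] by blast
      then obtain u where u: "u \<in> Lp_functions M p" "A = ?cl u" by (rule Lp_spaceE)
      obtain \<epsilon> where \<epsilon>: "\<epsilon> > 0" "Lp.mball A \<epsilon> \<subseteq> U"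
        using U A unfolding Lp_topology_def Lp.openin_mtopology by blast
      have "positive_lower_density {n. Lp_norm M p (\<lambda>x. \<phi> ((f ^^ n) x) - u x) < \<epsilon>}"
        using r u(1) \<epsilon>(1) unfolding fhc_function_def by blast
      then have "positive_lower_density {n. (?T ^^ n) (?cl \<phi>) \<in> U}"
      proof (rule positive_lower_density_mono, intro subsetI CollectI)
        fix n assume n: "n \<in> {n. Lp_norm M p (\<lambda>x. \<phi> ((f ^^ n) x) - u x) < \<epsilon>}"
        have "(?T ^^ n) (?cl \<phi>) \<in> Lp_space M p"
          using \<phi> by (simp add: composition_operator_iterate Lp_class_in_space iterate_in_Lp_functions)
        then show "(?T ^^ n) (?cl \<phi>) \<in> U"
          using n dist[OF u(1) \<phi>] u \<epsilon>(2) by (auto simp: Lp_class_in_space)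
      qed
      then show "0 < liminf (\<lambda>N. ereal (real (card {n \<in> {1..N}. (?T ^^ n) (?cl \<phi>) \<in> U}) / real N))"
        by (simp add: positive_lower_density_iff_liminf)
    qed
  qed
  note class_iff = this
  show ?thesis
  proof
    assume "frequently_hypercyclic ?L ?T"
    then obtain A where A: "A \<in> Lp_space M p" "\<forall>U. openin ?L U \<and> U \<noteq> {} \<longrightarrow>
        0 < liminf (\<lambda>N. ereal (real (card {n \<in> {1..N}. (?T ^^ n) A \<in> U}) / real N))"
      unfolding frequently_hypercyclic_def topspace_Lp[OF p] by blast
    obtain \<phi> where "\<phi> \<in> Lp_functions M p" "A = ?cl \<phi>" using A(1) by (rule Lp_spaceE)
    then show "\<exists>\<phi> :: 'a \<Rightarrow> 'k. fhc_function M p f \<phi>" using class_iff A(2) by blast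
  next
    assume "\<exists>\<phi> :: 'a \<Rightarrow> 'k. fhc_function M p f \<phi>"
    then obtain \<phi> :: "'a \<Rightarrow> 'k" where \<phi>: "fhc_function M p f \<phi>" by blast
    then have "\<phi> \<in> Lp_functions M p" by (simp add: fhc_function_def)
    then show "frequently_hypercyclic ?L ?T"
      unfolding frequently_hypercyclic_def topspace_Lp[OF p]
      using class_iff \<phi> Lp_class_in_space by blast
  qed
qed

end

section \<open>Maps that agree or are mutually inverse on the underlying space\<close>

lemma frequently_hypercyclic_cong:
  assumes "\<And>x. x \<in> topspace \<T> \<Longrightarrow> T x \<in> topspace \<T>"
    and "\<And>x. x \<in> topspace \<T> \<Longrightarrow> T x = T' x"
  shows "frequently_hypercyclic \<T> T \<longleftrightarrow> frequently_hypercyclic \<T> T'"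
proof -
  have "(T ^^ n) x \<in> topspace \<T> \<and> (T ^^ n) x = (T' ^^ n) x" if "x \<in> topspace \<T>" for n x
    using that assms by (induction n) auto
  then show ?thesis unfolding frequently_hypercyclic_def by (auto cong: conj_cong)
qed

lemma funpow_inverse_on:
  assumes "\<And>x. x \<in> S \<Longrightarrow> T x \<in> S" "\<And>x. x \<in> S \<Longrightarrow> T' (T x) = x" "x \<in> S"
  shows "(T' ^^ n) ((T ^^ n) x) = x" "(T ^^ n) x \<in> S"
proof -
  have "(T ^^ n) x \<in> S \<and> (T' ^^ n) ((T ^^ n) x) = x"
    using assms by (induction n) (auto simp: funpow_swap1[of T'])
  then show "(T' ^^ n) ((T ^^ n) x) = x" "(T ^^ n) x \<in> S" by auto
qed

text \<open>An orbit segment from \<open>V\<close> to \<open>U\<close> under \<open>T\<close>, run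
  backwards, leads from \<open>U\<close> to \<open>V\<close> under \<open>T'\<close>; a point and
  its period are the same for both maps.\<close>

lemma chaotic_inverse:
  assumes "\<And>x. x \<in> topspace \<T> \<Longrightarrow> T x \<in> topspace \<T>" "\<And>x. x \<in> topspace \<T> \<Longrightarrow> T' (T x) = x"
    and "\<And>x. x \<in> topspace \<T> \<Longrightarrow> T' x \<in> topspace \<T>" "\<And>x. x \<in> topspace \<T> \<Longrightarrow> T (T' x) = x"
    and "chaotic \<T> T"
  shows "chaotic \<T> T'"
proof -
  note pow = funpow_inverse_on[of "topspace \<T>" T T', OF assms(1,2)]
  note pow' = funpow_inverse_on[of "topspace \<T>" T' T, OF assms(3,4)]
  have "periodic_points \<T> T' = periodic_points \<T> T"
    unfolding periodic_points_def using pow(1) pow'(1) by (intro Collect_cong conj_cong refl) metis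
  moreover have "topologically_transitive \<T> T'"
    unfolding topologically_transitive_def
  proof (intro allI impI)
    fix U V assume UV: "openin \<T> U \<and> U \<noteq> {} \<and> openin \<T> V \<and> V \<noteq> {}"
    then obtain k where k: "k > 0" "(T ^^ k) ` V \<inter> U \<noteq> {}"
      using assms(5) unfolding chaotic_def topologically_transitive_def by blast
    then obtain x where "x \<in> V" "(T ^^ k) x \<in> U" by auto
    moreover from this have "(T' ^^ k) ((T ^^ k) x) = x"
      using UV openin_subset pow(1) by blast
    ultimately show "\<exists>k>0. (T' ^^ k) ` U \<inter> V \<noteq> {}"
      using k(1) by (metis disjoint_iff imageI)
  qed
  ultimately show ?thesis using assms(5) by (simp add: chaotic_def)
qed

section \<open>Dissipative systems\<close>

text \<open>Both maps are parameters, so that exchanging them is time reversal, see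
  \<open>flow_swap\<close>.\<close>

definition flow :: "('a \<Rightarrow> 'a) \<Rightarrow> ('a \<Rightarrow> 'a) \<Rightarrow> int \<Rightarrow> 'a \<Rightarrow> 'a" where
  "flow f g k = (if k \<ge> 0 then f ^^ nat k else g ^^ nat (- k))"

lemma flow_swap: "flow g f k = flow f g (- k)"
  by (cases "k = 0") (auto simp: flow_def)

lemma flow_of_nat: "flow f g (int n) = f ^^ n"
  by (simp add: flow_def)

lemma flow_0: "flow f g 0 = id"
  by (simp add: flow_def)

lemma int_iterate_eq_flow: "int_iterate X f = flow f (inv_into X f)"
  by (simp add: fun_eq_iff int_iterate_def flow_def)

text \<open>The inverse is a separate map \<open>g\<close> to make the hypotheses symmetric: a
  result for \<open>f\<close> holds for \<open>g\<close> through \<open>swap\<close>. Taking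
  \<open>inv_into\<close> twice would return \<open>f\<close> only on
  \<open>space M\<close>.\<close>

locale two_sided_system = measurable_system M f + inverse: measurable_system M g
  for M :: "'a measure" and f g :: "'a \<Rightarrow> 'a" +
  assumes g_f: "x \<in> space M \<Longrightarrow> g (f x) = x"
    and f_g: "x \<in> space M \<Longrightarrow> f (g x) = x"
begin

lemma f_in_space: "x \<in> space M \<Longrightarrow> f x \<in> space M"
  using bij by (auto simp: bij_betw_def)

lemma g_in_space: "x \<in> space M \<Longrightarrow> g x \<in> space M"
  using inverse.bij by (auto simp: bij_betw_def)

lemma flow_in_space: "x \<in> space M \<Longrightarrow> flow f g k x \<in> space M"
proof -
  assume x: "x \<in> space M"
  have "(f ^^ n) x \<in> space M" "(g ^^ n) x \<in> space M" for n
    using x by (induction n) (auto simp: f_in_space g_in_space)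
  then show ?thesis by (simp add: flow_def)
qed

lemma flow_Suc:
  assumes "x \<in> space M"
  shows "flow f g (k + 1) x = f (flow f g k x)"
proof (cases "k \<ge> 0")
  case True
  then show ?thesis by (simp add: flow_def nat_add_distrib)
next
  case False
  then obtain n where n: "k = - int (Suc n)"
    by (metis int_cases of_nat_0_le_iff)
  have "flow f g (k + 1) x = (g ^^ n) x"
    by (cases "n = 0") (auto simp: flow_def n nat_minus_as_int)
  moreover have "flow f g k x = g ((g ^^ n) x)" by (simp add: flow_def n nat_add_distrib)
  moreover have "(g ^^ n) x \<in> space M"
    using flow_in_space[OF assms, of "- int n"] by (cases "n = 0") (auto simp: flow_def)
  ultimately show ?thesis by (simp add: f_g)
qed

lemma flow_pred:
  assumes "x \<in> space M"
  shows "flow f g (k - 1) x = g (flow f g k x)"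
  using flow_Suc[OF assms, of "k - 1"] g_f[OF flow_in_space[OF assms, of "k - 1"]] by simp

lemma flow_add:
  assumes "x \<in> space M"
  shows "flow f g (a + b) x = flow f g a (flow f g b x)"
proof (induction a rule: int_induct[where k = 0])
  case base
  then show ?case by (simp add: flow_0)
next
  case (step1 a)
  have "a + 1 + b = (a + b) + 1" by simp
  then show ?case using step1 by (simp only: flow_Suc flow_in_space assms)
next
  case (step2 a)
  have "a - 1 + b = (a + b) - 1" by simp
  then show ?case using step2 by (simp only: flow_pred flow_in_space assms)
qed

lemma flow_minus:
  assumes "x \<in> space M"
  shows "flow f g (- k) (flow f g k x) = x" "flow f g k (flow f g (- k) x) = x"
  using flow_add[OF assms, of "- k" k] flow_add[OF assms, of k "- k"] by (simp_all add: flow_0)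

lemma flow_measurable [measurable]: "flow f g k \<in> measurable M M"
proof -
  have "f ^^ n \<in> measurable M M" "g ^^ n \<in> measurable M M" for n
    using measurable_f inverse.measurable_f by (induction n) (auto intro!: measurable_comp)
  then show ?thesis by (simp add: flow_def)
qed

lemma flow_image:
  assumes "B \<subseteq> space M"
  shows "flow f g k ` B = flow f g (- k) -` B \<inter> space M"
proof (intro equalityI subsetI)
  fix x assume "x \<in> flow f g k ` B"
  then show "x \<in> flow f g (- k) -` B \<inter> space M"
    using assms flow_minus flow_in_space by auto
next
  fix x assume x: "x \<in> flow f g (- k) -` B \<inter> space M"
  then have "x = flow f g k (flow f g (- k) x)" by (simp add: flow_minus)
  then show "x \<in> flow f g k ` B" using x by blast
qed

lemma flow_image_sets: "B \<in> sets M \<Longrightarrow> flow f g k ` B \<in> sets M"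
  using sets.sets_into_space by (subst flow_image) (auto intro: measurable_sets)

lemma image_bound:
  "\<exists>c::real. c > 0 \<and> (\<forall>B\<in>sets M. emeasure M (f ` B) \<le> ennreal c * emeasure M B)"
proof -
  have "f ` B = g -` B \<inter> space M" if "B \<in> sets M" for B
    using flow_image[of B 1] sets.sets_into_space[OF that] by (simp add: flow_def)
  then show ?thesis using inverse.vimage_bound by simp
qed

lemma swap: "two_sided_system M g f"
  by (intro two_sided_system.intro two_sided_system_axioms.intro
      measurable_system_axioms inverse.measurable_system_axioms g_f f_g)

end

section \<open>The tower of levels over a wandering set\<close>

locale tower = two_sided_system M f g
  for M :: "'a measure" and f g :: "'a \<Rightarrow> 'a" +
  fixes W :: "'a set"
  assumes W_sets: "W \<in> sets M"
    and W_pos: "emeasure M W > 0"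
    and W_finite: "emeasure M W < \<infinity>"
    and disjoint_levels: "disjoint_family (\<lambda>k. flow f g k ` W)"
    and levels_cover: "space M = (\<Union>k. flow f g k ` W)"
begin

definition level :: "int \<Rightarrow> 'a set" where
  "level k = flow f g k ` W"

text \<open>The time coordinate on the tower; \<open>f\<close> raises it by one. It is meaningful
  only on \<open>space M\<close>, the union of the levels.\<close>

definition index :: "'a \<Rightarrow> int" where
  "index x = (THE k. x \<in> level k)"

definition window :: "nat \<Rightarrow> 'a set" where
  "window m = (\<Union>k\<in>{- int m..int m}. level k)"

lemma W_space: "W \<subseteq> space M"
  using W_sets by (rule sets.sets_into_space)

lemma level_0: "level 0 = W"
  by (simp add: level_def flow_0)

lemma level_sets [measurable]: "level k \<in> sets M"
  unfolding level_def by (rule flow_image_sets[OF W_sets])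

lemma level_disjoint: "x \<in> level j \<Longrightarrow> x \<in> level k \<Longrightarrow> j = k"
  using disjoint_levels by (auto simp: disjoint_family_on_def level_def)

lemma index_eq: "x \<in> level k \<Longrightarrow> index x = k"
  unfolding index_def by (rule the_equality) (auto dest: level_disjoint)

lemma level_index: "x \<in> space M \<Longrightarrow> x \<in> level (index x)"
  using levels_cover index_eq by (fastforce simp: level_def[symmetric])

lemma in_level_iff: "x \<in> space M \<Longrightarrow> x \<in> level k \<longleftrightarrow> index x = k"
  using index_eq level_index by blast

lemma index_measurable [measurable]: "index \<in> measurable M (count_space UNIV)"
proof (rule measurable_count_space_eq_countable[THEN iffD2])
  show "index \<in> space M \<rightarrow> UNIV \<and> (\<forall>k\<in>UNIV. index -` {k} \<inter> space M \<in> sets M)"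
  proof (intro conjI ballI)
    fix k :: int
    have "index -` {k} \<inter> space M = level k"
      using in_level_iff sets.sets_into_space[OF level_sets[of k]] by auto
    then show "index -` {k} \<inter> space M \<in> sets M" by simp
  qed simp
qed simp

lemma index_flow:
  assumes "x \<in> space M"
  shows "index (flow f g k x) = index x + k"
proof -
  obtain w where w: "w \<in> W" "x = flow f g (index x) w"
    using level_index[OF assms] by (auto simp: level_def)
  then have "w \<in> space M" using W_space by blast
  then have "flow f g k x = flow f g (k + index x) w"
    using w(2) flow_add[of w k "index x"] by simp
  then have "flow f g k x \<in> level (k + index x)" using w(1) by (simp add: level_def)
  then show ?thesis using index_eq by simp
qed

lemma f_level: "f ` level k = level (k + 1)"
  unfolding level_def image_image using W_space flow_Suc by (intro image_cong refl) fastforce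

lemma g_level: "g ` level k = level (k - 1)"
  unfolding level_def image_image using W_space flow_pred by (intro image_cong refl) fastforce

lemma window_sets [measurable]: "window m \<in> sets M"
  unfolding window_def by (intro sets.finite_UN) auto

lemma in_window_iff: "x \<in> space M \<Longrightarrow> x \<in> window m \<longleftrightarrow> \<bar>index x\<bar> \<le> int m"
  by (auto simp: window_def in_level_iff)

lemma window_subset: "window m \<subseteq> space M"
  using window_sets by (rule sets.sets_into_space)

lemma incseq_window: "incseq window"
  unfolding incseq_def window_def by (intro allI impI UN_mono) auto

lemma UN_window: "(\<Union>m. window m) = space M"
proof
  show "space M \<subseteq> (\<Union>m. window m)"
  proof
    fix x assume x: "x \<in> space M"
    then have "x \<in> window (nat \<bar>index x\<bar>)" by (simp add: in_window_iff)
    then show "x \<in> (\<Union>m. window m)" by blast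
  qed
qed (use window_subset in blast)

lemma swap_tower: "tower M g f W"
proof (intro tower.intro tower_axioms.intro swap W_sets W_pos W_finite)
  have eq: "flow g f k ` W = level (- k)" for k by (simp add: flow_swap[of g f] level_def)
  show "disjoint_family (\<lambda>k. flow g f k ` W)"
    unfolding eq disjoint_family_on_def using level_disjoint by fastforce
  have "space M = (\<Union>k. level k)" using levels_cover by (simp add: level_def)
  also have "\<dots> = (\<Union>k. level (- k))"
  proof (intro equalityI UN_least)
    fix k
    show "level k \<subseteq> (\<Union>k. level (- k))" using UN_upper[of "- k" UNIV "\<lambda>k. level (- k)"] by simp
  qed auto
  finally show "space M = (\<Union>k. flow g f k ` W)" unfolding eq .
qed

lemma level_bound:
  obtains c where "c \<ge> 1" "\<And>k. emeasure M (level (k + 1)) \<le> ennreal c * emeasure M (level k)"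
    "\<And>k. emeasure M (level k) \<le> ennreal c * emeasure M (level (k + 1))"
proof -
  obtain a where a: "a > 0" "\<And>B. B \<in> sets M \<Longrightarrow> emeasure M (f ` B) \<le> ennreal a * emeasure M B"
    using image_bound by blast
  obtain b where b: "b > 0" "\<And>B. B \<in> sets M \<Longrightarrow> emeasure M (g ` B) \<le> ennreal b * emeasure M B"
    using two_sided_system.image_bound[OF swap] by blast
  define c where "c = max 1 (max a b)"
  have le: "ennreal a * x \<le> ennreal c * x" "ennreal b * x \<le> ennreal c * x" for x
    using a(1) b(1) by (auto simp: c_def intro!: mult_right_mono ennreal_leI)
  show thesis
  proof (rule that[of c])
    fix k
    show "emeasure M (level (k + 1)) \<le> ennreal c * emeasure M (level k)"
      using a(2)[OF level_sets[of k]] le(1) unfolding f_level by (rule order_trans)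
    show "emeasure M (level k) \<le> ennreal c * emeasure M (level (k + 1))"
      using b(2)[OF level_sets[of "k + 1"]] le(2) unfolding g_level by (simp add: order_trans)
  qed (simp add: c_def)
qed

lemma level_finite: "emeasure M (level k) < \<infinity>"
proof -
  obtain c where c: "c \<ge> 1" "\<And>k. emeasure M (level (k + 1)) \<le> ennreal c * emeasure M (level k)"
    "\<And>k. emeasure M (level k) \<le> ennreal c * emeasure M (level (k + 1))"
    by (rule level_bound) blast
  show ?thesis
  proof (induction k rule: int_induct[where k = 0])
    case base
    then show ?case using W_finite by (simp add: level_0)
  next
    case (step1 k)
    then have "ennreal c * emeasure M (level k) < \<infinity>" by (simp add: ennreal_mult_less_top)
    then show ?case using c(2)[of k] by (rule le_less_trans[rotated])
  next
    case (step2 k)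
    then have "ennreal c * emeasure M (level k) < \<infinity>" by (simp add: ennreal_mult_less_top)
    then show ?case using c(3)[of "k - 1"] by (simp add: le_less_trans)
  qed
qed

lemma emeasure_level: "emeasure M (level k) = ennreal (measure M (level k))"
  using level_finite[of k] by (simp add: emeasure_eq_ennreal_measure)

lemma measure_level_bound:
  obtains c where "c \<ge> 1" "\<And>k. measure M (level (k + 1)) \<le> c * measure M (level k)"
    "\<And>k. measure M (level k) \<le> c * measure M (level (k + 1))"
proof -
  obtain c where c: "c \<ge> 1" "\<And>k. emeasure M (level (k + 1)) \<le> ennreal c * emeasure M (level k)"
    "\<And>k. emeasure M (level k) \<le> ennreal c * emeasure M (level (k + 1))"
    by (rule level_bound) blast
  show thesis
    by (rule that[of c])
       (use c in \<open>simp_all add: emeasure_level ennreal_le_iff flip: ennreal_mult'\<close>)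
qed

text \<open>A window is a finite disjoint union of levels, and the windows increase to the whole
  space.\<close>

lemma emeasure_space_finite_if_sums_bounded:
  assumes "\<And>F. finite F \<Longrightarrow> (\<Sum>k\<in>F. measure M (level k)) \<le> B"
  shows "emeasure M (space M) < \<infinity>"
proof -
  have "emeasure M (window m) \<le> ennreal B" for m
  proof -
    have "emeasure M (window m) = (\<Sum>k\<in>{- int m..int m}. emeasure M (level k))"
      unfolding window_def
      by (intro sum_emeasure[symmetric]) (auto simp: disjoint_family_on_def dest: level_disjoint)
    also have "\<dots> = ennreal (\<Sum>k\<in>{- int m..int m}. measure M (level k))"
      by (simp add: emeasure_level sum_ennreal)
    also have "\<dots> \<le> ennreal B" by (intro ennreal_leI assms) simp
    finally show ?thesis .
  qed
  then have "(SUP m. emeasure M (window m)) \<le> ennreal B" by (intro SUP_least)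
  also have "(SUP m. emeasure M (window m)) = emeasure M (space M)"
    using SUP_emeasure_incseq[of window M] incseq_window UN_window window_sets by (simp add: image_subset_iff)
  finally show ?thesis by (rule le_less_trans) simp
qed

end

section \<open>Frequent hypercyclicity forces a finite measure\<close>

lemma indicator_in_Lp_functions:
  assumes "B \<in> sets M" "emeasure M B < \<infinity>"
  shows "(indicator B :: 'a \<Rightarrow> 'k::{real_normed_field,banach,second_countable_topology}) \<in> Lp_functions M p"
proof -
  have "norm (indicator B x :: 'k) powr p = indicator B x" for x by (simp add: indicator_def)
  then show ?thesis using assms by (simp add: Lp_functions_def integrable_real_indicator)
qed

context tower
begin

text \<open>For fixed \<open>n\<close> in \<open>E\<close>, the sets \<open>C m\<close> moved to
  level \<open>m - n\<close> are disjoint and, for \<open>m\<close> other than \<open>n\<close>, lie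
  in the small set \<open>Bd n\<close>. Each \<open>C m\<close> fills at least half of
  \<open>W\<close>, so \<open>distortion\<close> makes its copy a fixed share of that level. The
  measures of these levels thus have a sum bounded independently of \<open>n\<close>.\<close>

lemma emeasure_space_finite:
  fixes \<phi> :: "'a \<Rightarrow> 'k::{real_normed_field,banach,second_countable_topology}"
  assumes p: "p \<ge> 1" and K: "K > 0"
    and distortion: "\<And>k C. C \<in> sets M \<Longrightarrow> C \<subseteq> W \<Longrightarrow>
      measure M (level k) * measure M C \<le> K * measure M W * measure M (flow f g k ` C)"
    and fhc: "fhc_function M p f \<phi>"
  shows "emeasure M (space M) < \<infinity>"
proof -
  define w where "w = measure M W"
  have w: "w > 0"
    using W_pos W_finite by (simp add: w_def measure_def enn2real_positive_iff)
  have \<phi>: "\<phi> \<in> Lp_functions M p" using fhc by (simp add: fhc_function_def)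
  let ?i = "indicator W :: 'a \<Rightarrow> 'k"
  have i: "?i \<in> Lp_functions M p" by (rule indicator_in_Lp_functions[OF W_sets W_finite])
  \<comment> \<open>Chosen so that Markov's inequality bounds the set of deviations of at least
    \<open>1 / 2\<close> by half the measure of \<open>W\<close>.\<close>
  define e where "e = ((1 / 2) powr p * (w / 2)) powr (1 / p)"
  have e: "e > 0" using w by (simp add: e_def)
  define E where "E = {n. Lp_norm M p (\<lambda>x. \<phi> ((f ^^ n) x) - ?i x) < e}"
  have E: "positive_lower_density E"
    using fhc i e unfolding fhc_function_def E_def by blast
  define Bd where "Bd n = {x \<in> space M. norm (\<phi> ((f ^^ n) x) - ?i x) \<ge> 1 / 2}" for n
  define C where "C n = {x \<in> W. norm (\<phi> ((f ^^ n) x)) \<ge> 1 / 2}" for n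
  have \<phi>n: "(\<lambda>x. \<phi> ((f ^^ n) x)) \<in> Lp_functions M p" for n
    by (rule iterate_in_Lp_functions[OF \<phi>])
  note [measurable] = Lp_functions_measurable[OF \<phi>n] Lp_functions_measurable[OF i] W_sets
  have Bd_sets [measurable]: "Bd n \<in> sets M" for n unfolding Bd_def by measurable
  have C_sets [measurable]: "C n \<in> sets M" for n
  proof -
    have "C n = W \<inter> {x \<in> space M. norm (\<phi> ((f ^^ n) x)) \<ge> 1 / 2}"
      using W_space by (auto simp: C_def)
    then show ?thesis by simp
  qed
  have Bd_le: "emeasure M (Bd n) \<le> ennreal (w / 2)" if n: "n \<in> E" for n
  proof -
    let ?u = "\<lambda>x. norm (\<phi> ((f ^^ n) x) - ?i x) powr p"
    have int: "integrable M ?u"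
      using Lp_functions_diff[OF p \<phi>n i] by (simp add: Lp_functions_def)
    have "Lp_norm M p (\<lambda>x. \<phi> ((f ^^ n) x) - ?i x) powr p \<le> e powr p"
      using n p by (intro powr_mono2) (auto simp: E_def Lp_norm_def)
    then have le: "integral\<^sup>L M ?u \<le> (1 / 2) powr p * (w / 2)"
      using p w by (simp add: Lp_norm_powr e_def powr_powr)
    have "Bd n \<subseteq> {x \<in> space M. ?u x \<ge> (1 / 2) powr p}"
      using p by (auto simp: Bd_def intro!: powr_mono2)
    then have "emeasure M (Bd n) \<le> emeasure M {x \<in> space M. ?u x \<ge> (1 / 2) powr p}"
      by (intro emeasure_mono) measurable
    also have "\<dots> \<le> ennreal (1 / (1 / 2) powr p * integral\<^sup>L M ?u)"
      using int by (intro integral_Markov_inequality) auto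
    also have "\<dots> \<le> ennreal (w / 2)"
      using le by (intro ennreal_leI) (simp add: divide_le_eq mult.commute)
    finally show ?thesis .
  qed
  have Bd_fin: "emeasure M (Bd n) < \<infinity>" and Bd_measure: "measure M (Bd n) \<le> w / 2" if "n \<in> E" for n
  proof -
    show "emeasure M (Bd n) < \<infinity>" using Bd_le[OF that] by (rule le_less_trans) simp
    then show "measure M (Bd n) \<le> w / 2"
      using Bd_le[OF that] w by (simp add: emeasure_eq_ennreal_measure ennreal_le_iff)
  qed
  have C_ge: "measure M (C n) \<ge> w / 2" if "n \<in> E" for n
  proof -
    \<comment> \<open>On \<open>W\<close> the indicator is \<open>1\<close>, so either the value of
      the iterate or its deviation has norm at least \<open>1 / 2\<close>.\<close>
    have "W \<subseteq> C n \<union> Bd n"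
    proof
      fix x assume x: "x \<in> W"
      have "1 \<le> norm (\<phi> ((f ^^ n) x)) + norm (\<phi> ((f ^^ n) x) - 1)"
        using norm_triangle_ineq4[of "\<phi> ((f ^^ n) x)" "\<phi> ((f ^^ n) x) - 1"] by simp
      then show "x \<in> C n \<union> Bd n" using x W_space by (auto simp: C_def Bd_def)
    qed
    have C_fin: "emeasure M (C n) < \<infinity>"
      using emeasure_mono[of "C n" W M] W_sets W_finite by (auto simp: C_def le_less_trans)
    have "w \<le> measure M (C n \<union> Bd n)"
      unfolding w_def
    proof (rule measure_mono_fmeasurable)
      show "C n \<union> Bd n \<in> fmeasurable M"
        using C_fin Bd_fin[OF that] by (intro fmeasurable.Un fmeasurableI) auto
    qed (use \<open>W \<subseteq> C n \<union> Bd n\<close> W_sets in auto)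
    also have "\<dots> \<le> measure M (C n) + measure M (Bd n)"
      by (intro measure_Un_le) auto
    finally show ?thesis using Bd_measure[OF that] by simp
  qed
  let ?u = "\<lambda>k. measure M (level k)"
  obtain c where c: "c \<ge> 1" "\<And>k. ?u (k + 1) \<le> c * ?u k" "\<And>k. ?u k \<le> c * ?u (k + 1)"
    by (rule measure_level_bound) blast
  have return: "(\<Sum>m\<in>F. ?u (int m - int n)) \<le> w + K * w"
    if n: "n \<in> E" and F: "finite F" "F \<subseteq> E" for n F
  proof -
    let ?S = "\<lambda>m. flow f g (int m - int n) ` C m"
    have S_sets: "?S m \<in> sets M" for m by (rule flow_image_sets) simp
    have S_level: "?S m \<subseteq> level (int m - int n)" for m by (auto simp: C_def level_def)
    \<comment> \<open>At the moved point the \<open>n\<close>-th iterate takes the value that the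
      \<open>m\<close>-th takes at \<open>x\<close>, which is large. For \<open>m \<noteq> n\<close>
      the point is off \<open>W\<close>, where the indicator is \<open>0\<close>, so the deviation
      is large.\<close>
    have S_Bd: "?S m \<subseteq> Bd n" if "m \<noteq> n" for m
    proof
      fix y assume y: "y \<in> ?S m"
      then obtain x where x: "x \<in> C m" "y = flow f g (int m - int n) x" by blast
      have xs: "x \<in> space M" using x(1) W_space by (auto simp: C_def)
      have "(f ^^ n) y = flow f g (int n + (int m - int n)) x"
        by (simp only: flow_add[OF xs] x(2) flow_of_nat)
      also have "\<dots> = (f ^^ m) x" by (simp add: flow_of_nat)
      finally have "norm (\<phi> ((f ^^ n) y)) \<ge> 1 / 2" using x(1) by (simp add: C_def)
      moreover have "y \<notin> W"
        using y S_level[of m] level_disjoint[of y "int m - int n" 0] that by (auto simp: level_0)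
      ultimately show "y \<in> Bd n" using flow_in_space[OF xs] x(2) by (simp add: Bd_def)
    qed
    \<comment> \<open>The term \<open>m = n\<close> is split off at the cost of \<open>w\<close>:
      its piece lies in \<open>W\<close> itself, where \<open>S_Bd\<close> gives no
      information.\<close>
    have "(\<Sum>m\<in>F. ?u (int m - int n)) \<le> ?u 0 + (\<Sum>m\<in>F-{n}. ?u (int m - int n))"
    proof (cases "n \<in> F")
      case True
      then show ?thesis using sum.remove[OF F(1), of n "\<lambda>m. ?u (int m - int n)"] by simp
    qed simp
    also have "?u 0 = w" by (simp add: level_0 w_def)
    also have "(\<Sum>m\<in>F-{n}. ?u (int m - int n)) \<le> (\<Sum>m\<in>F-{n}. 2 * K * measure M (?S m))"
    proof (rule sum_mono)
      fix m assume m: "m \<in> F - {n}"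
      have "?u (int m - int n) * (w / 2) \<le> ?u (int m - int n) * measure M (C m)"
        using m F by (intro mult_left_mono C_ge) auto
      also have "\<dots> \<le> K * w * measure M (?S m)"
        unfolding w_def by (intro distortion) (auto simp: C_def)
      finally show "?u (int m - int n) \<le> 2 * K * measure M (?S m)" using w by simp
    qed
    also have "\<dots> = 2 * K * measure M (\<Union>m\<in>F-{n}. ?S m)"
    proof -
      have "disjoint_family_on ?S (F - {n})"
        unfolding disjoint_family_on_def
      proof (intro ballI impI equals0I)
        fix m m' y assume "m \<noteq> m'" "y \<in> ?S m \<inter> ?S m'"
        then have "int m - int n = int m' - int n"
          using S_level[of m] S_level[of m'] by (intro level_disjoint[of y]) auto
        then show False using \<open>m \<noteq> m'\<close> by simp
      qed
      moreover have "emeasure M (?S m) \<noteq> \<infinity>" if "m \<in> F - {n}" for m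
        using emeasure_mono[OF S_Bd Bd_sets[of n]] Bd_fin[OF n] that by (metis DiffD2 insertI1 not_le infinity_ennreal_def)
      ultimately have "measure M (\<Union>m\<in>F-{n}. ?S m) = (\<Sum>m\<in>F-{n}. measure M (?S m))"
        using F S_sets by (intro measure_finite_Union) auto
      then show ?thesis by (simp add: sum_distrib_left)
    qed
    also have "\<dots> \<le> 2 * K * measure M (Bd n)"
    proof (intro mult_left_mono measure_mono_fmeasurable)
      show "Bd n \<in> fmeasurable M" using Bd_fin[OF n] by (intro fmeasurableI) auto
      show "(\<Union>m\<in>F-{n}. ?S m) \<subseteq> Bd n" using S_Bd by blast
      show "(\<Union>m\<in>F-{n}. ?S m) \<in> sets M" using F S_sets by (intro sets.finite_UN) auto
    qed (use K in simp)
    also have "\<dots> \<le> 2 * K * (w / 2)" using K Bd_measure[OF n] by (intro mult_left_mono) auto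
    finally show ?thesis by simp
  qed
  obtain B where "\<And>F. finite F \<Longrightarrow> sum ?u F \<le> B"
    by (rule sums_bounded_if_return_sums_bounded[of ?u c E "w + K * w", OF _ c E return]) auto
  then show ?thesis by (rule emeasure_space_finite_if_sums_bounded)
qed

end

section \<open>Frequently hypercyclic functions on finite measure spaces\<close>

lemma Lp_norm_triangle_via:
  assumes p: "p \<ge> 1" and "a \<in> Lp_functions M p" "b \<in> Lp_functions M p" "c \<in> Lp_functions M p"
  shows "Lp_norm M p (\<lambda>x. a x - c x) \<le> Lp_norm M p (\<lambda>x. a x - b x) + Lp_norm M p (\<lambda>x. b x - c x)"
proof -
  have "Lp_norm M p (\<lambda>x. c x - b x) = Lp_norm M p (\<lambda>x. b x - c x)"
    by (simp add: Lp_norm_def norm_minus_commute)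
  then show ?thesis
    using Lp_norm_triangle[OF p Lp_functions_diff[OF p assms(2,3)] Lp_functions_diff[OF p assms(4,3)]]
    by simp
qed

lemma Lp_functionsI_nn_integral:
  fixes a :: "'a \<Rightarrow> 'k::{real_normed_field,banach,second_countable_topology}"
  assumes [measurable]: "a \<in> borel_measurable M"
    and "(\<integral>\<^sup>+x. ennreal (norm (a x) powr p) \<partial>M) < \<infinity>"
  shows "a \<in> Lp_functions M p"
  using assms by (auto simp: Lp_functions_def intro!: integrableI_bounded)

lemma Lp_norm_le_nn_integral:
  fixes a :: "'a \<Rightarrow> 'k::{real_normed_field,banach,second_countable_topology}"
  assumes p: "p \<ge> 1" and [measurable]: "a \<in> borel_measurable M"
    and "(\<integral>\<^sup>+x. ennreal (norm (a x) powr p) \<partial>M) \<le> ennreal r" "r \<ge> 0"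
  shows "Lp_norm M p a \<le> r powr (1 / p)"
proof -
  have "(\<integral>x. norm (a x) powr p \<partial>M) \<le> r"
    using assms(3,4) by (intro integral_real_bounded) auto
  then show ?thesis using p unfolding Lp_norm_def by (intro powr_mono2) auto
qed

section \<open>Tails, truncation and the construction of the function\<close>

context tower
begin

text \<open>Continuity from above along the complements of the windows. The measure \<open>N\<close>
  is kept apart from \<open>M\<close> because tails are needed both for \<open>M\<close> and for a
  density.\<close>

lemma exists_small_tail:
  assumes "sets N = sets M" "emeasure N (space M) < \<infinity>" "e > 0"
  obtains h where "h \<ge> h0" "emeasure N (space M - window h) \<le> ennreal e"
proof -
  have "(\<lambda>h. emeasure N (space M - window h)) \<longlonglongrightarrow> emeasure N (\<Inter>h. space M - window h)"
  proof (rule Lim_emeasure_decseq)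
    show "range (\<lambda>h. space M - window h) \<subseteq> sets N"
      unfolding assms(1) by (intro image_subsetI sets.Diff sets.top window_sets)
    show "decseq (\<lambda>h. space M - window h)"
      unfolding decseq_def using incseq_window by (intro allI impI Diff_mono order_refl) (rule incseqD)
    fix h
    have "emeasure N (space M - window h) \<le> emeasure N (space M)"
      by (rule emeasure_mono) (unfold assms(1), simp_all)
    then have "emeasure N (space M - window h) < \<infinity>" using assms(2) by (rule le_less_trans)
    then show "emeasure N (space M - window h) \<noteq> \<infinity>" by simp
  qed
  also have "(\<Inter>h. space M - window h) = {}"
  proof (rule equals0I)
    fix x assume "x \<in> (\<Inter>h. space M - window h)"
    then have "x \<in> space M" "x \<notin> (\<Union>h. window h)" by auto
    then show False unfolding UN_window by contradiction
  qed
  finally have "(\<lambda>h. emeasure N (space M - window h)) \<longlonglongrightarrow> 0" by simp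
  moreover have "0 < ennreal e" using assms(3) by simp
  ultimately have "\<forall>\<^sub>F h in sequentially. emeasure N (space M - window h) < ennreal e"
    by (rule order_tendstoD)
  then obtain h1 where "\<And>h. h \<ge> h1 \<Longrightarrow> emeasure N (space M - window h) < ennreal e"
    unfolding eventually_sequentially by blast
  then show thesis using that[of "max h0 h1"] by (simp add: less_imp_le)
qed

text \<open>Dominated convergence. A single parameter \<open>m\<close> limits both the height and
  the support; each point of the space lies in \<open>A m\<close> for all large \<open>m\<close>,
  where the difference is exactly zero.\<close>

lemma exists_truncation:
  fixes z :: "'a \<Rightarrow> 'k::{real_normed_field,banach,second_countable_topology}"
  assumes p: "p \<ge> 1" and z: "z \<in> Lp_functions M p" and e: "e > 0"
  obtains m y where "y \<in> Lp_functions M p" "\<And>x. norm (y x) \<le> real m"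
    "\<And>x. x \<notin> window m \<Longrightarrow> y x = 0" "Lp_norm M p (\<lambda>x. y x - z x) < e"
proof -
  define A where "A m = {x \<in> window m. norm (z x) \<le> real m}" for m
  define y where "y m x = (if x \<in> A m then z x else 0)" for m x
  note [measurable] = Lp_functions_measurable[OF z]
  have A_sets [measurable]: "A m \<in> sets M" for m
  proof -
    have "A m = window m \<inter> {x \<in> space M. norm (z x) \<le> real m}"
      using window_subset by (auto simp: A_def)
    then show ?thesis by simp
  qed
  have y_meas [measurable]: "y m \<in> borel_measurable M" for m
    unfolding y_def by measurable
  have int: "integrable M (\<lambda>x. norm (z x) powr p)" using z by (simp add: Lp_functions_def)
  have "(\<lambda>m. \<integral>x. norm (y m x - z x) powr p \<partial>M) \<longlonglongrightarrow> (\<integral>x. 0 \<partial>M)"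
  proof (rule integral_dominated_convergence[OF _ _ int])
    show "AE x in M. (\<lambda>m. norm (y m x - z x) powr p) \<longlonglongrightarrow> 0"
    proof (rule AE_I2)
      fix x assume x: "x \<in> space M"
      have "\<forall>\<^sub>F m in sequentially. real m \<ge> max \<bar>index x\<bar> (norm (z x))"
        using filterlim_real_sequentially unfolding filterlim_at_top by blast
      then have "\<forall>\<^sub>F m in sequentially. norm (y m x - z x) powr p = 0"
        by eventually_elim (use x in \<open>simp add: y_def A_def in_window_iff, linarith\<close>)
      then show "(\<lambda>m. norm (y m x - z x) powr p) \<longlonglongrightarrow> 0" by (rule tendsto_eventually)
    qed
    show "AE x in M. norm (norm (y m x - z x) powr p) \<le> norm (z x) powr p" for m
      by (simp add: y_def)
  qed measurable
  then have "(\<lambda>m. \<integral>x. norm (y m x - z x) powr p \<partial>M) \<longlonglongrightarrow> 0" by simp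
  then have "\<forall>\<^sub>F m in sequentially. (\<integral>x. norm (y m x - z x) powr p \<partial>M) < e powr p"
    by (rule order_tendstoD(2)) (use e in simp)
  then obtain m where m: "(\<integral>x. norm (y m x - z x) powr p \<partial>M) < e powr p"
    by (auto simp: eventually_sequentially)
  then have "Lp_norm M p (\<lambda>x. y m x - z x) < (e powr p) powr (1 / p)"
    unfolding Lp_norm_def using p by (intro powr_less_mono2) auto
  then have "Lp_norm M p (\<lambda>x. y m x - z x) < e" using p e by (simp add: powr_powr)
  moreover have "integrable M (\<lambda>x. norm (y m x) powr p)"
    by (rule Bochner_Integration.integrable_bound[OF int]) (auto simp: y_def)
  then have "y m \<in> Lp_functions M p" by (simp add: Lp_functions_def)
  ultimately show thesis using that[of "y m" m] by (simp add: y_def A_def)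
qed

text \<open>Copies of truncations of \<open>z l\<close> are placed around well separated times. The
  errors become small only as \<open>l\<close> grows, which is why \<open>dense\<close> asks for
  infinitely many good \<open>l\<close> rather than one.\<close>

lemma exists_fhc_function:
  fixes z :: "nat \<Rightarrow> 'a \<Rightarrow> 'k::{real_normed_field,banach,second_countable_topology}"
  assumes p: "p \<ge> 1" and fin: "emeasure M (space M) < \<infinity>"
    and z: "\<And>l. z l \<in> Lp_functions M p"
    and dense: "\<And>u e. u \<in> Lp_functions M p \<Longrightarrow> e > 0 \<Longrightarrow> infinite {l. Lp_norm M p (\<lambda>x. z l x - u x) < e}"
  shows "\<exists>\<psi> :: 'a \<Rightarrow> 'k. fhc_function M p f \<psi>"
proof -
  have "\<exists>m y. y \<in> Lp_functions M p \<and> (\<forall>x. norm (y x) \<le> real m) \<and> (\<forall>x. x \<notin> window m \<longrightarrow> y x = 0) \<and>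
      Lp_norm M p (\<lambda>x. y x - z l x) < 1 / real (Suc l)" for l
    by (rule exists_truncation[OF p z[of l], of "1 / real (Suc l)"]) (simp, blast)
  then obtain m y where y: "\<And>l. y l \<in> Lp_functions M p" and y_le: "\<And>l x. norm (y l x) \<le> real (m l)"
    and y_0: "\<And>l x. x \<notin> window (m l) \<Longrightarrow> y l x = 0"
    and y_z: "\<And>l. Lp_norm M p (\<lambda>x. y l x - z l x) < 1 / real (Suc l)"
    by metis
  note [measurable] = Lp_functions_measurable[OF y]
  have "\<exists>h. ennreal (real (m l) powr p) * emeasure M (space M - window h) \<le> ennreal ((1 / 2) ^ l)" for l
  proof -
    \<comment> \<open>Finiteness of the measure enters here: even the constant \<open>m l\<close>,
      raised to the power \<open>p\<close>, has a tail integral of at most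
      \<open>(1 / 2) ^ l\<close>. The summand \<open>1\<close> keeps the denominator positive when
      \<open>m l = 0\<close>.\<close>
    obtain h where h: "emeasure M (space M - window h) \<le> ennreal ((1 / 2) ^ l / (real (m l) powr p + 1))"
      by (rule exists_small_tail[OF refl fin, of "(1 / 2) ^ l / (real (m l) powr p + 1)" 0])
         (auto intro!: divide_pos_pos add_nonneg_pos)
    have "ennreal (real (m l) powr p) * emeasure M (space M - window h)
      \<le> ennreal (real (m l) powr p) * ennreal ((1 / 2) ^ l / (real (m l) powr p + 1))"
      using h by (rule mult_left_mono) simp
    also have "\<dots> = ennreal (real (m l) powr p * ((1 / 2) ^ l / (real (m l) powr p + 1)))"
      by (rule ennreal_mult'[symmetric]) simp
    also have "\<dots> \<le> ennreal ((1 / 2) ^ l)"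
    proof (rule ennreal_leI)
      have "a * (b / (a + 1)) \<le> b" if "a \<ge> 0" "b \<ge> 0" for a b :: real
        using that by (simp add: field_simps)
      then show "real (m l) powr p * ((1 / 2) ^ l / (real (m l) powr p + 1)) \<le> (1 / 2) ^ l" by simp
    qed
    finally show ?thesis by blast
  qed
  then obtain h where h: "\<And>l. ennreal (real (m l) powr p) * emeasure M (space M - window (h l)) \<le> ennreal ((1 / 2) ^ l)"
    by metis
  txt \<open>\<open>H\<close> dominates \<open>\<bar>\<psi> \<circ> f ^^ n\<bar> powr p\<close> off the block centred at \<open>n\<close>, simultaneously for all \<open>n \<in> A l\<close>:
    a copy of \<open>y l'\<close> is only seen beyond distance \<open>h l'\<close>.\<close>
  define H where "H x = (\<Sum>l. ennreal (real (m l) powr p) * indicator (space M - window (h l)) x)" for x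
  have H_meas [measurable]: "H \<in> borel_measurable M" unfolding H_def by measurable
  have le_suminf: "F l \<le> suminf F" for F :: "nat \<Rightarrow> ennreal" and l
    using sum_le_suminf[of F "{l}"] by simp
  have H_ge: "ennreal (real (m l) powr p) \<le> H x" if "x \<in> space M" "\<bar>index x\<bar> > int (h l)" for l x
  proof -
    have "ennreal (real (m l) powr p) = ennreal (real (m l) powr p) * indicator (space M - window (h l)) x"
      using that by (simp add: in_window_iff)
    also have "\<dots> \<le> H x"
      unfolding H_def
      by (rule le_suminf)
    finally show ?thesis .
  qed
  have H_int: "(\<integral>\<^sup>+x. H x \<partial>M) < \<infinity>"
  proof -
    have "(\<integral>\<^sup>+x. H x \<partial>M) = (\<Sum>l. \<integral>\<^sup>+x. ennreal (real (m l) powr p) * indicator (space M - window (h l)) x \<partial>M)"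
      unfolding H_def by (rule nn_integral_suminf) measurable
    also have "\<dots> = (\<Sum>l. ennreal (real (m l) powr p) * emeasure M (space M - window (h l)))"
      by (intro suminf_cong nn_integral_cmult_indicator) measurable
    also have "\<dots> \<le> (\<Sum>l. ennreal ((1 / 2) ^ l))"
      using h by (intro suminf_le) auto
    also have "\<dots> = ennreal (\<Sum>l. (1 / 2) ^ l)"
      by (intro suminf_ennreal2) (auto intro: summable_geometric)
    also have "\<dots> < \<infinity>" by simp
    finally show ?thesis .
  qed
  \<comment> \<open>The separation radius does three things: \<open>m l\<close> keeps the copies
    disjoint, \<open>h l\<close> puts each foreign copy where \<open>H\<close> dominates it, and the
    tail condition makes all foreign copies together small. The summand \<open>1\<close> gives
    strict inequalities.\<close>
  have "\<exists>G. G \<ge> m l + h l + 1 \<and> emeasure (density M H) (space M - window G) \<le> ennreal (1 / real (Suc l))" for l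
  proof (rule exists_small_tail[of "density M H" "1 / real (Suc l)" "m l + h l + 1"])
    have "emeasure (density M H) (space M) = (\<integral>\<^sup>+x. H x \<partial>M)"
      by (simp add: emeasure_density cong: nn_integral_cong)
    then show "emeasure (density M H) (space M) < \<infinity>" using H_int by simp
  qed auto
  then obtain G where G_ge: "\<And>l. G l \<ge> m l + h l + 1"
    and G: "\<And>l. emeasure (density M H) (space M - window (G l)) \<le> ennreal (1 / real (Suc l))"
    by metis
  have "G l > 0" for l using G_ge[of l] by simp
  then obtain A where A: "\<And>l. positive_lower_density (A l)"
    and A_ge: "\<And>l n. n \<in> A l \<Longrightarrow> G l \<le> n"
    and A_sep: "\<And>l l' n n'. n \<in> A l \<Longrightarrow> n' \<in> A l' \<Longrightarrow> (l, n) \<noteq> (l', n') \<Longrightarrow>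
       int (G l) + int (G l') \<le> \<bar>int n - int n'\<bar>"
    using separated_positive_density_sets[of G] by blast
  txt \<open>\<open>P k (l, n)\<close>: the copy of \<open>y l\<close> centred at \<open>n \<in> A l\<close> may be nonzero on \<open>level k\<close>.\<close>
  define P where "P k ln \<longleftrightarrow> snd ln \<in> A (fst ln) \<and> \<bar>k - int (snd ln)\<bar> \<le> int (m (fst ln))" for k ln
  \<comment> \<open>At most one pair qualifies (\<open>P_unique\<close>), so the choice encodes a
    sum of disjointly supported copies without an infinite series.\<close>
  define \<psi> where "\<psi> x = (if \<exists>ln. P (index x) ln
    then y (fst (SOME ln. P (index x) ln)) (flow f g (- int (snd (SOME ln. P (index x) ln))) x) else 0)" for x
  have P_unique: "ln = ln'" if "P k ln" "P k ln'" for k ln ln'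
  proof (rule ccontr)
    assume "ln \<noteq> ln'"
    then have "int (G (fst ln)) + int (G (fst ln')) \<le> \<bar>int (snd ln) - int (snd ln')\<bar>"
      using that by (intro A_sep) (auto simp: P_def prod_eq_iff)
    then show False using that G_ge[of "fst ln"] G_ge[of "fst ln'"] unfolding P_def by linarith
  qed
  have \<psi>_eq: "\<psi> x = y l (flow f g (- int n) x)" if "P (index x) (l, n)" for x l n
  proof -
    have "(SOME ln. P (index x) ln) = (l, n)"
      using that P_unique by (intro some_equality) auto
    then show ?thesis using that by (auto simp: \<psi>_def)
  qed
  have \<psi>_0: "\<psi> x = 0" if "\<And>l n. \<not> P (index x) (l, n)" for x
    using that by (simp add: \<psi>_def)
  \<comment> \<open>For a fixed value of \<open>index\<close> the chosen pair is constant and the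
    expression measurable; \<open>index\<close> takes countably many values.\<close>
  have \<psi>_meas [measurable]: "\<psi> \<in> borel_measurable M"
    unfolding \<psi>_def
    by (rule measurable_compose_countable[where g = index and f = "\<lambda>k x. if \<exists>ln. P k ln
      then y (fst (SOME ln. P k ln)) (flow f g (- int (snd (SOME ln. P k ln))) x) else 0"]) measurable
  have iter_in: "(f ^^ n) x \<in> space M" and iter_index: "index ((f ^^ n) x) = index x + int n" if "x \<in> space M" for n x
    using flow_in_space[OF that, of "int n"] index_flow[OF that, of "int n"] by (simp_all add: flow_of_nat)
  have \<psi>_H: "ennreal (norm (\<psi> ((f ^^ n) x)) powr p) \<le> H x"
    if x: "x \<in> space M" and far: "\<And>l' n'. P (index x + int n) (l', n') \<Longrightarrow> \<bar>index x\<bar> > int (h l')" for n x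
  proof (cases "\<exists>l' n'. P (index x + int n) (l', n')")
    case True
    then obtain l' n' where P: "P (index x + int n) (l', n')" by blast
    then have "norm (\<psi> ((f ^^ n) x)) powr p \<le> real (m l') powr p"
      using p y_le by (intro powr_mono2) (auto simp: \<psi>_eq[of _ l' n'] iter_index[OF x])
    then have "ennreal (norm (\<psi> ((f ^^ n) x)) powr p) \<le> ennreal (real (m l') powr p)"
      by (rule ennreal_leI)
    also have "\<dots> \<le> H x" using x far[OF P] by (rule H_ge)
    finally show ?thesis .
  qed (simp add: \<psi>_0 iter_index[OF x])
  have \<psi>_Lp: "\<psi> \<in> Lp_functions M p"
  proof (rule Lp_functionsI_nn_integral)
    \<comment> \<open>At time \<open>0\<close> no copy is close: centres in \<open>A l'\<close> are
      at least \<open>G l'\<close>, so the copy is met only beyond distance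
      \<open>h l'\<close>.\<close>
    have "ennreal (norm (\<psi> x) powr p) \<le> H x" if "x \<in> space M" for x
    proof (rule \<psi>_H[OF that, of 0, simplified])
      fix l' n' assume P: "P (index x) (l', n')"
      then have "n' \<ge> G l'" using A_ge by (simp add: P_def)
      then show "int (h l') < \<bar>index x\<bar>" using P G_ge[of l'] unfolding P_def fst_conv snd_conv by linarith
    qed
    then have "(\<integral>\<^sup>+x. ennreal (norm (\<psi> x) powr p) \<partial>M) \<le> (\<integral>\<^sup>+x. H x \<partial>M)"
      by (rule nn_integral_mono)
    then show "(\<integral>\<^sup>+x. ennreal (norm (\<psi> x) powr p) \<partial>M) < \<infinity>" using H_int by (rule le_less_trans)
  qed measurable
  have \<psi>_y: "Lp_norm M p (\<lambda>x. \<psi> ((f ^^ n) x) - y l x) \<le> (1 / real (Suc l)) powr (1 / p)"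
    if n: "n \<in> A l" for n l
  proof (rule Lp_norm_le_nn_integral[OF p])
    note [measurable] = Lp_functions_measurable[OF iterate_in_Lp_functions[OF \<psi>_Lp, of n]]
    show "(\<lambda>x. \<psi> ((f ^^ n) x) - y l x) \<in> borel_measurable M" by measurable
    \<comment> \<open>Three zones: up to index \<open>m l\<close> the iterate equals
      \<open>y l\<close>; from there to \<open>G l\<close> both vanish; beyond \<open>G l\<close>
      only foreign copies remain, and \<open>H\<close> dominates them.\<close>
    have "ennreal (norm (\<psi> ((f ^^ n) x) - y l x) powr p) \<le> H x * indicator (space M - window (G l)) x"
      if x: "x \<in> space M" for x
    proof (cases "\<bar>index x\<bar> \<le> int (m l)")
      case True
      have "P (index ((f ^^ n) x)) (l, n)" using True n by (simp add: P_def iter_index[OF x])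
      then have "\<psi> ((f ^^ n) x) = y l x"
        using \<psi>_eq flow_minus(1)[OF x, of "int n"] by (simp add: flow_of_nat)
      then show ?thesis by simp
    next
      case False
      then have y0: "y l x = 0" using x by (intro y_0) (simp add: in_window_iff)
      have far: "\<bar>index x\<bar> > int (G l) + int (h l')" if P: "P (index x + int n) (l', n')" for l' n'
      proof -
        have "(l, n) \<noteq> (l', n')" using P False by (auto simp: P_def)
        then have "int (G l) + int (G l') \<le> \<bar>int n - int n'\<bar>"
          using n P by (intro A_sep) (auto simp: P_def)
        then show ?thesis using P G_ge[of l'] unfolding P_def fst_conv snd_conv by linarith
      qed
      show ?thesis
      proof (cases "x \<in> window (G l)")
        case True
        have "\<psi> ((f ^^ n) x) = 0"
        proof (rule \<psi>_0)
          fix l' n'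
          show "\<not> P (index ((f ^^ n) x)) (l', n')"
            using far[of l' n'] True x by (auto simp: iter_index in_window_iff)
        qed
        then show ?thesis by (simp add: y0)
      next
        case False
        have "ennreal (norm (\<psi> ((f ^^ n) x)) powr p) \<le> H x"
          using x by (rule \<psi>_H) (use far in force)
        then show ?thesis using False x by (simp add: y0)
      qed
    qed
    then have "(\<integral>\<^sup>+x. ennreal (norm (\<psi> ((f ^^ n) x) - y l x) powr p) \<partial>M)
      \<le> (\<integral>\<^sup>+x. H x * indicator (space M - window (G l)) x \<partial>M)"
      by (rule nn_integral_mono)
    also have "\<dots> = emeasure (density M H) (space M - window (G l))"
      by (simp add: emeasure_density)
    also note G
    finally show "(\<integral>\<^sup>+x. ennreal (norm (\<psi> ((f ^^ n) x) - y l x) powr p) \<partial>M) \<le> ennreal (1 / real (Suc l))" .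
  qed simp
  have "fhc_function M p f \<psi>"
    unfolding fhc_function_def
  proof (intro conjI ballI allI impI \<psi>_Lp)
    fix u :: "'a \<Rightarrow> 'k" and e :: real assume u: "u \<in> Lp_functions M p" and e: "e > 0"
    have lim: "(\<lambda>l. 1 / real (Suc l)) \<longlonglongrightarrow> 0" using LIMSEQ_inverse_real_of_nat by (simp add: inverse_eq_divide)
    have "(\<lambda>l. (1 / real (Suc l)) powr (1 / p)) \<longlonglongrightarrow> 0"
      using lim p by (intro tendsto_zero_powrI[where b = "1 / p"]) auto
    then have "\<forall>\<^sub>F l in sequentially. (1 / real (Suc l)) powr (1 / p) < e / 4"
      using e by (intro order_tendstoD) auto
    moreover have "\<forall>\<^sub>F l in sequentially. 1 / real (Suc l) < e / 4"
      using lim e by (intro order_tendstoD) auto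
    ultimately have "\<forall>\<^sub>F l in sequentially. (1 / real (Suc l)) powr (1 / p) < e / 4 \<and> 1 / real (Suc l) < e / 4"
      by (rule eventually_conj)
    then obtain L where L: "\<And>l. l \<ge> L \<Longrightarrow> (1 / real (Suc l)) powr (1 / p) < e / 4 \<and> 1 / real (Suc l) < e / 4"
      by (auto simp: eventually_sequentially)
    \<comment> \<open>Infinitely many good indices allow one beyond \<open>L\<close>, where the
      copying and truncation errors are each below \<open>e / 4\<close>.\<close>
    obtain l where l: "l \<ge> L" "Lp_norm M p (\<lambda>x. z l x - u x) < e / 2"
      using dense[OF u, of "e / 2"] e unfolding infinite_nat_iff_unbounded_le by auto
    show "positive_lower_density {n. Lp_norm M p (\<lambda>x. \<psi> ((f ^^ n) x) - u x) < e}"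
    proof (rule positive_lower_density_mono[OF A[of l]], intro subsetI CollectI)
      fix n assume n: "n \<in> A l"
      note \<psi>n = iterate_in_Lp_functions[OF \<psi>_Lp, of n]
      have "Lp_norm M p (\<lambda>x. \<psi> ((f ^^ n) x) - u x)
        \<le> Lp_norm M p (\<lambda>x. \<psi> ((f ^^ n) x) - y l x) + Lp_norm M p (\<lambda>x. y l x - u x)"
        by (rule Lp_norm_triangle_via[OF p \<psi>n y u])
      moreover have "Lp_norm M p (\<lambda>x. y l x - u x)
        \<le> Lp_norm M p (\<lambda>x. y l x - z l x) + Lp_norm M p (\<lambda>x. z l x - u x)"
        by (rule Lp_norm_triangle_via[OF p y z u])
      ultimately show "Lp_norm M p (\<lambda>x. \<psi> ((f ^^ n) x) - u x) < e"
        using \<psi>_y[OF n] y_z[of l] L[OF l(1)] l(2) by linarith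
    qed
  qed
  then show ?thesis by blast
qed

end

section \<open>Passing to the inverse\<close>

lemma (in two_sided_system) composition_operator_inverse:
  fixes A :: "('a \<Rightarrow> 'k::{real_normed_field,banach,second_countable_topology}) set"
  assumes "A \<in> Lp_space M p"
  shows "composition_operator M p g (composition_operator M p f A) = A"
  using assms
proof (rule Lp_spaceE)
  fix \<phi> :: "'a \<Rightarrow> 'k" assume \<phi>: "\<phi> \<in> Lp_functions M p" and A: "A = Lp_rel M p `` {\<phi>}"
  have "(\<phi> \<circ> f \<circ> g, \<phi>) \<in> Lp_rel M p"
    using \<phi> Lp_functions_compose inverse.Lp_functions_compose
    by (auto simp: Lp_rel_def f_g intro!: AE_I2)
  then have "Lp_rel M p `` {\<phi> \<circ> f \<circ> g} = A"
    unfolding A by (rule equiv_class_eq[OF equiv_Lp_rel])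
  then show ?thesis
    using \<phi> by (simp add: A composition_operator_class inverse.composition_operator_class Lp_functions_compose)
qed

text \<open>The construction is run on the time-reversed tower. Its dense sequence is the forward
  orbit of \<open>\<phi>\<close>: visits of positive lower density to a ball are infinitely
  many.\<close>

lemma (in tower) frequently_hypercyclic_inverse:
  assumes p: "p \<ge> 1" and K: "K > 0"
    and distortion: "\<And>k C. C \<in> sets M \<Longrightarrow> C \<subseteq> W \<Longrightarrow>
      measure M (flow f g k ` W) * measure M C \<le> K * measure M W * measure M (flow f g k ` C)"
    and fhc: "frequently_hypercyclic
      (Lp_topology M p :: ('a \<Rightarrow> 'k::{real_normed_field,banach,second_countable_topology}) set topology)
      (composition_operator M p f)"
  shows "frequently_hypercyclic (Lp_topology M p :: ('a \<Rightarrow> 'k) set topology) (composition_operator M p g)"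
proof -
  obtain \<phi> :: "'a \<Rightarrow> 'k" where \<phi>: "fhc_function M p f \<phi>"
    using fhc frequently_hypercyclic_iff_function[OF p] by blast
  then have \<phi>_Lp: "\<phi> \<in> Lp_functions M p" by (simp add: fhc_function_def)
  have "emeasure M (space M) < \<infinity>"
    by (rule emeasure_space_finite[OF p K _ \<phi>]) (simp add: level_def distortion)
  then have "\<exists>\<psi> :: 'a \<Rightarrow> 'k. fhc_function M p g \<psi>"
  proof (rule tower.exists_fhc_function[OF swap_tower p])
    show "(\<lambda>x. \<phi> ((f ^^ l) x)) \<in> Lp_functions M p" for l
      by (rule iterate_in_Lp_functions[OF \<phi>_Lp])
    show "infinite {l. Lp_norm M p (\<lambda>x. \<phi> ((f ^^ l) x) - u x) < e}"
      if "u \<in> Lp_functions M p" "e > 0" for u :: "'a \<Rightarrow> 'k" and e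
      using \<phi> that unfolding fhc_function_def by (intro positive_lower_density_infinite) simp
  qed
  then show ?thesis using inverse.frequently_hypercyclic_iff_function[OF p] by blast
qed

section \<open>From the given system to a two-sided tower\<close>

lemma (in invertible_measurable_system) two_sided_inv_into: "two_sided_system M f (inv_into (space M) f)"
proof -
  let ?g = "inv_into (space M) f"
  have gf: "?g (f x) = x" if "x \<in> space M" for x
    using bij that by (rule bij_betw_inv_into_left)
  have fg: "f (?g x) = x" if "x \<in> space M" for x
    using bij that by (rule bij_betw_inv_into_right)
  have g_in: "?g x \<in> space M" if "x \<in> space M" for x
    using bij_betw_inv_into[OF bij] that by (auto simp: bij_betw_def)
  have f_in: "f x \<in> space M" if "x \<in> space M" for x
    using bij that by (auto simp: bij_betw_def)
  \<comment> \<open>Images under the inverse are preimages under \<open>f\<close>, and conversely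
    below. This exchange turns \<open>image_bound\<close> into the preimage bound required of the
    inverse.\<close>
  have g_image: "?g ` B = f -` B \<inter> space M" if "B \<in> sets M" for B
  proof (intro equalityI subsetI)
    fix x assume "x \<in> f -` B \<inter> space M"
    then show "x \<in> ?g ` B" by (intro rev_image_eqI[of "f x"]) (simp_all add: gf)
  next
    fix x assume "x \<in> ?g ` B"
    then obtain b where b: "b \<in> B" "x = ?g b" by blast
    then have "b \<in> space M" using sets.sets_into_space[OF that] by blast
    then show "x \<in> f -` B \<inter> space M" using b by (simp add: fg g_in)
  qed
  have g_vimage: "?g -` B \<inter> space M = f ` B" if "B \<in> sets M" for B
  proof (intro equalityI subsetI)
    fix x assume "x \<in> ?g -` B \<inter> space M"
    then show "x \<in> f ` B" by (intro rev_image_eqI[of "?g x"]) (simp_all add: fg)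
  next
    fix x assume "x \<in> f ` B"
    then obtain b where b: "b \<in> B" "x = f b" by blast
    then have "b \<in> space M" using sets.sets_into_space[OF that] by blast
    then show "x \<in> ?g -` B \<inter> space M" using b by (simp add: gf f_in)
  qed
  have f_vimage_image: "f -` (f ` B) \<inter> space M = B" if "B \<in> sets M" for B
    using sets.sets_into_space[OF that] bij by (auto simp: bij_betw_def inj_on_def)
  show ?thesis
  proof (intro two_sided_system.intro two_sided_system_axioms.intro measurable_system_axioms gf fg
      measurable_system.intro measurable_system_axioms.intro sigma_finite_measure_axioms space_pos)
    show "bij_betw ?g (space M) (space M)" by (rule bij_betw_inv_into[OF bij])
    show "\<exists>c::real. c > 0 \<and> (\<forall>B\<in>sets M. emeasure M (?g -` B \<inter> space M) \<le> ennreal c * emeasure M B)"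
      using image_bound by (simp add: g_vimage)
    fix B assume B: "B \<in> sets M"
    show "?g ` B \<in> sets M" using B by (simp add: g_image vimage_sets)
    show "?g -` B \<inter> space M \<in> sets M" using B by (simp add: g_vimage image_sets)
    show "emeasure M (?g -` B \<inter> space M) = 0 \<longleftrightarrow> emeasure M B = 0"
      using nonsingular[OF image_sets[OF B]] B by (simp add: g_vimage f_vimage_image)
  qed
qed

text \<open>Levels have finite measure, so the lower distortion inequality passes to the reals.
  Clearing denominators extends it to null sets \<open>C\<close>.\<close>

lemma (in two_sided_system) bounded_distortion_tower:
  assumes "bounded_distortion M f" and g: "g = inv_into (space M) f"
  obtains W K where "tower M f g W" "K > 0"
    "\<And>k C. C \<in> sets M \<Longrightarrow> C \<subseteq> W \<Longrightarrow>
      measure M (flow f g k ` W) * measure M C \<le> K * measure M W * measure M (flow f g k ` C)"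
proof -
  have it: "int_iterate (space M) f = flow f g" by (simp add: g int_iterate_eq_flow)
  obtain W K where W: "wandering M f W" "0 < emeasure M W" "emeasure M W < \<infinity>"
      "space M = (\<Union>k. flow f g k ` W)" and K: "(K::real) > 0"
    and dist: "\<And>k C. C \<in> sets M \<Longrightarrow> C \<subseteq> W \<Longrightarrow> emeasure M C > 0 \<Longrightarrow>
      ennreal (1 / K) * (emeasure M (flow f g k ` W) / emeasure M W)
        \<le> emeasure M (flow f g k ` C) / emeasure M C"
  proof -
    obtain W and K :: real where WK: "wandering M f W \<and> 0 < emeasure M W \<and> emeasure M W < \<infinity> \<and> K > 0 \<and>
        space M = (\<Union>k. flow f g k ` W) \<and>
        (\<forall>k. \<forall>C\<in>sets M. C \<subseteq> W \<and> emeasure M C > 0 \<longrightarrow>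
          ennreal (1 / K) * (emeasure M (flow f g k ` W) / emeasure M W)
            \<le> emeasure M (flow f g k ` C) / emeasure M C \<and>
          emeasure M (flow f g k ` C) / emeasure M C
            \<le> ennreal K * (emeasure M (flow f g k ` W) / emeasure M W))"
      using assms(1)[unfolded bounded_distortion_def it] by (elim exE)
    show thesis
      by (rule that[of W K]) (use WK in simp_all)
  qed
  have wandering: "W \<in> sets M" "disjoint_family (\<lambda>k. flow f g k ` W)"
    using W(1) unfolding wandering_def it by auto
  interpret tower M f g W
    by (unfold_locales; fact W wandering)
  show thesis
  proof (rule that[OF tower_axioms K])
    fix k C assume C: "C \<in> sets M" "C \<subseteq> W"
    let ?a = "measure M (flow f g k ` W)" and ?w = "measure M W" and ?c = "measure M C"
      and ?s = "measure M (flow f g k ` C)"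
    have fin: "emeasure M B = ennreal (measure M B)" if "B \<subseteq> level k" "B \<in> sets M" for B k
      using emeasure_mono[OF that(1) level_sets] level_finite[of k]
      by (intro emeasure_eq_ennreal_measure) (auto simp: top_unique)
    have w: "emeasure M W = ennreal ?w" "?w > 0"
      using fin[of W 0] W_sets W_pos by (auto simp: level_0)
    show "?a * ?c \<le> K * ?w * ?s"
    proof (cases "?c = 0")
      case True
      then show ?thesis using K by simp
    next
      case False
      then have c: "emeasure M C = ennreal ?c" "?c > 0"
        using fin[of C 0] C by (auto simp: level_0 zero_less_measure_iff)
      have "ennreal (1 / K) * (ennreal ?a / ennreal ?w) \<le> ennreal ?s / ennreal ?c"
        using dist[OF C, of k] c w fin[of "flow f g k ` W" k] fin[of "flow f g k ` C" k] C W_sets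
        by (auto simp: level_def flow_image_sets image_mono)
      then have "1 / K * (?a / ?w) \<le> ?s / ?c"
        using K w(2) c(2)
        by (simp add: divide_ennreal ennreal_le_iff flip: ennreal_mult')
      then show ?thesis using K w(2) c(2) by (simp add: field_simps)
    qed
  qed
qed

theorem corollary3p8:
  fixes M :: "'a measure" and f :: "'a \<Rightarrow> 'a" and p :: real
  assumes "invertible_measurable_system M f"
    and "dissipative M f"
    and "bounded_distortion M f"
    and "p \<ge> 1"
  shows "let L = (Lp_topology M p ::
               ('a \<Rightarrow> 'k::{real_normed_field,banach,second_countable_topology}) set topology);
             Tf = composition_operator M p f;
             Tf_inverse = inv_into (Lp_space M p) Tf
         in (frequently_hypercyclic L Tf \<longleftrightarrow> frequently_hypercyclic L Tf_inverse) \<and>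
            (chaotic L Tf \<longleftrightarrow> chaotic L Tf_inverse)"
proof -
  define g where "g = inv_into (space M) f"
  define L where "L = (Lp_topology M p :: ('a \<Rightarrow> 'k) set topology)"
  define Tf where "Tf = (composition_operator M p f :: ('a \<Rightarrow> 'k) set \<Rightarrow> _)"
  define Tg where "Tg = (composition_operator M p g :: ('a \<Rightarrow> 'k) set \<Rightarrow> _)"
  define Ti where "Ti = inv_into (Lp_space M p) Tf"
  interpret two_sided_system M f g
    unfolding g_def by (rule invertible_measurable_system.two_sided_inv_into[OF assms(1)])
  interpret swapped: two_sided_system M g f by (rule swap)
  obtain W K where tower: "tower M f g W" and K: "K > 0"
    and distortion: "\<And>k C. C \<in> sets M \<Longrightarrow> C \<subseteq> W \<Longrightarrow>
      measure M (flow f g k ` W) * measure M C \<le> K * measure M W * measure M (flow f g k ` C)"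
    using bounded_distortion_tower[OF assms(3) g_def] by blast
  have top: "topspace L = Lp_space M p" unfolding L_def by (rule topspace_Lp[OF assms(4)])
  have in_space: "Tf A \<in> topspace L" "Tg A \<in> topspace L" if "A \<in> topspace L" for A
    using that unfolding top Tf_def Tg_def
    by (simp_all add: composition_operator_in_space inverse.composition_operator_in_space)
  have inverses: "Tg (Tf A) = A" "Tf (Tg A) = A" if "A \<in> topspace L" for A
    using that unfolding top Tf_def Tg_def
    by (simp_all add: composition_operator_inverse swapped.composition_operator_inverse)
  \<comment> \<open>Both are inverses of \<open>Tf\<close> on the space, so they agree there;
    outside it no agreement is claimed.\<close>
  have Ti: "Ti A = Tg A" if "A \<in> topspace L" for A
  proof -
    have "inj_on Tf (topspace L)" by (rule inj_on_inverseI[of _ Tg]) (rule inverses)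
    then have "Ti (Tf (Tg A)) = Tg A"
      unfolding Ti_def top[symmetric] by (rule inv_into_f_f) (rule in_space[OF that])
    then show ?thesis using inverses[OF that] by simp
  qed
  have "frequently_hypercyclic L Tf \<longleftrightarrow> frequently_hypercyclic L Tg"
  proof
    assume "frequently_hypercyclic L Tf"
    then show "frequently_hypercyclic L Tg"
      unfolding L_def Tf_def Tg_def
      by (rule tower.frequently_hypercyclic_inverse[OF tower assms(4) K, rotated]) (rule distortion)
  next
    assume "frequently_hypercyclic L Tg"
    then show "frequently_hypercyclic L Tf"
      unfolding L_def Tf_def Tg_def
    \<comment> \<open>The reversed tower has the same base and the same constant:
      \<open>distortion\<close> ranges over all integers, so reversing the sign of \<open>k\<close>
      preserves it.\<close>
    proof (rule tower.frequently_hypercyclic_inverse[OF tower.swap_tower[OF tower] assms(4) K, rotated])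
      fix k C assume "C \<in> sets M" "C \<subseteq> W"
      then show "measure M (flow g f k ` W) * measure M C \<le> K * measure M W * measure M (flow g f k ` C)"
        unfolding flow_swap[of g f] by (rule distortion)
    qed
  qed
  moreover have "frequently_hypercyclic L Tg \<longleftrightarrow> frequently_hypercyclic L Ti"
    by (rule frequently_hypercyclic_cong) (simp_all add: in_space Ti)
  moreover have "chaotic L Tf \<longleftrightarrow> chaotic L Ti"
    using chaotic_inverse[of L Tf Ti] chaotic_inverse[of L Ti Tf] in_space inverses Ti by auto
  ultimately show ?thesis
    unfolding Let_def L_def[symmetric] Tf_def[symmetric] Ti_def[symmetric] by blast
qed

end
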